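(* Let $p$ be an odd prime, let $1\leq H\leq (p-1)/2$ be an integer and let $t\in\mathbb{F}_p^{*}$. Then \[ N_3([-H,H];t)=(1+o(1))\frac{(2H+1)^9}{p} \] provided $H=\omega(p^{3/5})$.
   Context: $\mathbb{F}_p=\mathbb{Z}/p\mathbb{Z}$, and $[-H,H]$ denotes the set of residues modulo $p$ of the integers in $[-H,H]$ (which has $2H+1$ elements since $H\le (p-1)/2$). For a set $\mathcal{A}\subseteq\mathbb{F}_p$ and $t\in\mathbb{F}_p$, $N_3(\mathcal{A};t)$ denotes the number of $3\times 3$ matrices with all entries in $\mathcal{A}$ whose determinant equals $t$ in $\mathbb{F}_p$. Asymptotics refer to $p\to\infty$; $H=\omega(p^{3/5})$ means $H/p^{3/5}\to\infty$, and $o(1)$ denotes a quantity tending to $0$. *)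

theory Defs
  imports
    "HOL-Analysis.Analysis"
    "HOL-Library.Landau_Symbols"
    "HOL-Number_Theory.Cong"
    "HOL-Computational_Algebra.Primes"
begin

text \<open>
  Since \<open>p\<close> varies, \<open>\<int>/p\<int>\<close> is not a fixed type here: its elements are represented by the
  integers in \<open>{0..<int p}\<close>. Reduction modulo \<open>p\<close> being a ring homomorphism, the determinant of a
  matrix over \<open>\<int>/p\<int>\<close> is the residue class of the integer determinant of its representative.
\<close>

definition residue_interval :: "nat \<Rightarrow> nat \<Rightarrow> int set" where
  "residue_interval p H = (\<lambda>x. x mod int p) ` {- int H..int H}"

definition N3 :: "nat \<Rightarrow> int set \<Rightarrow> int \<Rightarrow> nat" where
  "N3 p A t = card {M :: int^3^3. (\<forall>i j. M $ i $ j \<in> A) \<and> [det M = t] (mod int p)}"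

end

theory Submission
  imports Defs
begin

text \<open>
  Expanding the determinant along its last row writes the number of matrices as the sum of
  \<open>M t (u \<times> v)\<close> over pairs \<open>u, v\<close> in the box, where \<open>M t w\<close> counts the points of the box on
  the plane \<open>r \<bullet> w = t\<close>. With \<open>N = 2 H + 1\<close>, the expected value of \<open>M t w\<close> is \<open>\<mu> = N\<^sup>3 / p\<close>.

  If \<open>v \<bullet> w = v' \<bullet> w = t \<noteq> 0\<close> and \<open>v\<close>, \<open>v'\<close> are parallel, then \<open>v = v'\<close>; a second moment
  computation therefore gives \<open>\<Sum>w. (M t w - \<mu>)\<^sup>2 \<le> 3 p\<^sup>2 N\<^sup>3\<close>. By Cauchy--Schwarz it remains to bound
  the number of solutions of \<open>u \<times> v = u' \<times> v' \<noteq> 0\<close>, which is at most \<open>N\<close> times the number \<open>T\<close> of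
  singular matrices with first two rows independent (\<open>u'\<close> is orthogonal to \<open>u \<times> v\<close>, and \<open>v'\<close> lies
  on a line parallel to \<open>u'\<close>). Each such matrix is annihilated by \<open>p - 1\<close> nonzero vectors, so \<open>T\<close> is
  controlled by the third moment of \<open>M 0\<close>, and hence by its variance. This variance
  is at most \<open>p\<^sup>2 D + p\<^sup>3\<close>, where \<open>D\<close> counts the pairs of parallel vectors in the box.

  Finally \<open>D \<le> N\<^sup>3 + (\<Sum>c. J\<^sub>c\<^sup>3)\<close>, where \<open>J\<^sub>c\<close> counts the points of the lattice \<open>b \<equiv> c a (mod p)\<close> in
  the square of side \<open>2 H\<close>. Either \<open>J\<^sub>c = 1\<close>, or a shortest nonzero vector of norm \<open>s\<close> gives
  \<open>J\<^sub>c \<le> 12 H\<^sup>2 / p + 3 H / s\<close>, and distinct \<open>c\<close> have distinct shortest vectors, so the sum of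
  \<open>1 / s\<^sup>3\<close> is bounded. Altogether the relative error is \<open>O((p\<^sup>3 / N\<^sup>5) powr (1/2))\<close>.
\<close>

subsection \<open>Vectors modulo a prime\<close>

type_synonym vec = "int \<times> int \<times> int"

fun dot :: "vec \<Rightarrow> vec \<Rightarrow> int" where
  "dot (a, b, c) (x, y, z) = a * x + b * y + c * z"

fun cross :: "vec \<Rightarrow> vec \<Rightarrow> vec" where
  "cross (a, b, c) (x, y, z) = (b * z - c * y, c * x - a * z, a * y - b * x)"

fun scale :: "int \<Rightarrow> vec \<Rightarrow> vec" where
  "scale s (a, b, c) = (s * a, s * b, s * c)"

fun null :: "int \<Rightarrow> vec \<Rightarrow> bool" where
  "null p (a, b, c) \<longleftrightarrow> p dvd a \<and> p dvd b \<and> p dvd c"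

fun red :: "int \<Rightarrow> vec \<Rightarrow> vec" where
  "red p (a, b, c) = (a mod p, b mod p, c mod p)"

definition cube :: "int set \<Rightarrow> vec set" where
  "cube S = S \<times> S \<times> S"

text \<open>One notion covers both index sets in use: the symmetric interval, where the variables
  live, and the full residue system \<open>{0..<p}\<close>, over which moments are taken.\<close>

definition separated :: "int \<Rightarrow> int set \<Rightarrow> bool" where
  "separated p S \<longleftrightarrow> finite S \<and> (\<forall>x\<in>S. \<forall>y\<in>S. p dvd x - y \<longrightarrow> x = y)"

lemma finite_cube [simp]: "finite S \<Longrightarrow> finite (cube S)"
  by (simp add: cube_def)

lemma card_cube: "card (cube S) = card S ^ 3"
  by (simp add: cube_def card_cartesian_product power3_eq_cube)

lemma null_diff_cube_imp_eq:
  assumes "separated p S" "x \<in> cube S" "y \<in> cube S" "null p (x - y)"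
  shows "x = y"
  using assms by (cases x; cases y) (auto simp: separated_def cube_def)

lemma dot_diff_right: "dot v (x - y) = dot v x - dot v y"
  by (cases v; cases x; cases y) (simp add: algebra_simps)

lemma dot_diff_left: "dot (x - y) v = dot x v - dot y v"
  by (cases v; cases x; cases y) (simp add: algebra_simps)

lemma dot_commute: "dot u v = dot v u"
  by (cases u; cases v) (simp add: algebra_simps)

lemma cross_diff_right: "cross v (x - y) = cross v x - cross v y"
  by (cases v; cases x; cases y) (simp add: algebra_simps)

text \<open>The vector triple product. It converts orthogonality relations modulo \<open>p\<close>
  into parallelism, and is used for this throughout.\<close>

lemma cross_cross: "cross w (cross u v) = scale (dot w v) u - scale (dot w u) v"
  by (cases u; cases v; cases w) (simp add: algebra_simps)

lemma dot_cross_self: "dot u (cross u v) = 0" "dot v (cross u v) = 0"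
  by (cases u; cases v; simp add: algebra_simps)+

lemma null_scale: "p dvd s \<or> null p v \<Longrightarrow> null p (scale s v)"
  by (cases v) auto

lemma null_scaleD: "prime p \<Longrightarrow> null p (scale s v) \<Longrightarrow> p dvd s \<or> null p v"
  by (cases v) (auto simp: prime_dvd_mult_iff)

lemma null_diff: "null p u \<Longrightarrow> null p v \<Longrightarrow> null p (u - v)"
  by (cases u; cases v) auto

lemma null_cross_commute: "null p (cross u v) \<longleftrightarrow> null p (cross v u)"
  by (cases u; cases v) (auto simp: dvd_diff_commute algebra_simps)

lemma null_dot: "null p v \<Longrightarrow> p dvd dot v w"
  by (cases v; cases w) auto

section \<open>Upper bounds for points of a box on planes and lines\<close>

text \<open>Some coefficient of \<open>c\<close> is invertible modulo \<open>p\<close>, so the other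
  two coordinates determine a point of the plane.\<close>

lemma card_plane_le:
  assumes "prime p" "separated p S" "\<not> null p c"
  shows "card {x \<in> cube S. p dvd dot c x - t} \<le> card S ^ 2"
proof -
  have fS: "finite S" using assms by (simp add: separated_def)
  obtain a b d where c: "c = (a, b, d)" by (cases c)
  define X where "X = {x \<in> cube S. p dvd dot c x - t}"
  have sol: "p dvd dot c (x - y)" if "x \<in> X" "y \<in> X" for x y
  proof -
    have "p dvd (dot c x - t) - (dot c y - t)"
      using that unfolding X_def mem_Collect_eq by (metis dvd_diff)
    then show ?thesis by (simp add: dot_diff_right)
  qed
  have main: "card X \<le> card S ^ 2"
    if inj: "inj_on f X" and im: "f ` X \<subseteq> S \<times> S" for f :: "vec \<Rightarrow> int \<times> int"
  proof -
    have "card X \<le> card (S \<times> S)"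
      using inj im fS by (intro card_inj_on_le) auto
    then show ?thesis by (simp add: card_cartesian_product power2_eq_square)
  qed
  have eq: "x = y" if "x \<in> X" "y \<in> X"
    "(\<not> p dvd a \<and> snd x = snd y) \<or> (\<not> p dvd b \<and> fst x = fst y \<and> snd (snd x) = snd (snd y))
      \<or> (\<not> p dvd d \<and> fst x = fst y \<and> fst (snd x) = fst (snd y))" for x y
  proof (rule null_diff_cube_imp_eq[OF assms(2)])
    show "x \<in> cube S" "y \<in> cube S" using that by (auto simp: X_def)
    show "null p (x - y)"
      using sol[OF that(1,2)] that(3) assms(1)
      by (cases x; cases y) (auto simp: c prime_dvd_mult_iff)
  qed
  from assms(3) c consider "\<not> p dvd a" | "\<not> p dvd b" | "\<not> p dvd d" by auto
  then have "card X \<le> card S ^ 2"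
  proof cases
    case 1
    show ?thesis
    proof (rule main)
      show "inj_on (\<lambda>(x, y, z). (y, z)) X"
        using 1 by (intro inj_onI eq) auto
      show "(\<lambda>(x, y, z). (y, z)) ` X \<subseteq> S \<times> S" by (auto simp: X_def cube_def)
    qed
  next
    case 2
    show ?thesis
    proof (rule main)
      show "inj_on (\<lambda>(x, y, z). (x, z)) X"
        using 2 by (intro inj_onI eq) auto
      show "(\<lambda>(x, y, z). (x, z)) ` X \<subseteq> S \<times> S" by (auto simp: X_def cube_def)
    qed
  next
    case 3
    show ?thesis
    proof (rule main)
      show "inj_on (\<lambda>(x, y, z). (x, y)) X"
        using 3 by (intro inj_onI eq) auto
      show "(\<lambda>(x, y, z). (x, y)) ` X \<subseteq> S \<times> S" by (auto simp: X_def cube_def)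
    qed
  qed
  then show ?thesis by (simp add: X_def)
qed

text \<open>Where \<open>c\<close> has an invertible coordinate, a vector parallel to
  \<open>c\<close> vanishes as soon as that coordinate does, so this coordinate is injective on
  \<open>X\<close>. Stating the hypothesis through differences covers both affine lines and fibres
  of \<open>cross u\<close>.\<close>

lemma card_parallel_le:
  assumes "prime p" "separated p S" "\<not> null p c" "X \<subseteq> cube S"
    and par: "\<And>x y. x \<in> X \<Longrightarrow> y \<in> X \<Longrightarrow> null p (cross c (x - y))"
  shows "card X \<le> card S"
proof -
  have fS: "finite S" using assms by (simp add: separated_def)
  obtain a b d where c: "c = (a, b, d)" by (cases c)
  have main: "card X \<le> card S" if "inj_on f X" "f ` X \<subseteq> S" for f
    using that fS by (intro card_inj_on_le)
  have eq: "x = y" if "x \<in> X" "y \<in> X"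
    "(\<not> p dvd a \<and> fst x = fst y) \<or> (\<not> p dvd b \<and> fst (snd x) = fst (snd y))
      \<or> (\<not> p dvd d \<and> snd (snd x) = snd (snd y))" for x y
  proof (rule null_diff_cube_imp_eq[OF assms(2)])
    show "x \<in> cube S" "y \<in> cube S" using that assms(4) by auto
    show "null p (x - y)"
      using par[OF that(1,2)] that(3) assms(1)
      by (cases x; cases y) (auto simp: c prime_dvd_mult_iff)
  qed
  from assms(3) c consider "\<not> p dvd a" | "\<not> p dvd b" | "\<not> p dvd d" by auto
  then show ?thesis
  proof cases
    case 1
    with eq assms(4) show ?thesis
      by (intro main[of fst] inj_onI) (auto simp: cube_def)
  next
    case 2
    with eq assms(4) show ?thesis
      by (intro main[of "\<lambda>x. fst (snd x)"] inj_onI) (auto simp: cube_def)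
  next
    case 3
    with eq assms(4) show ?thesis
      by (intro main[of "\<lambda>x. snd (snd x)"] inj_onI) (auto simp: cube_def)
  qed
qed

text \<open>The difference of two solutions is orthogonal to \<open>u\<close> and \<open>v\<close>,
  hence parallel to \<open>cross u v\<close> by the triple product.\<close>

lemma card_line_le:
  assumes "prime p" "separated p S" "\<not> null p (cross u v)"
  shows "card {w \<in> cube S. p dvd dot u w - s \<and> p dvd dot v w - t} \<le> card S"
proof (rule card_parallel_le[OF assms])
  fix x y
  assume x: "x \<in> {w \<in> cube S. p dvd dot u w - s \<and> p dvd dot v w - t}"
    and y: "y \<in> {w \<in> cube S. p dvd dot u w - s \<and> p dvd dot v w - t}"
  have "p dvd (dot u x - s) - (dot u y - s)" "p dvd (dot v x - t) - (dot v y - t)"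
    using x y unfolding mem_Collect_eq by (metis dvd_diff)+
  then have "p dvd dot (x - y) u" "p dvd dot (x - y) v"
    by (simp_all add: dot_diff_right dot_commute[of "x - y"])
  then have "null p (cross (x - y) (cross u v))"
    unfolding cross_cross by (intro null_diff null_scale) auto
  then show "null p (cross (cross u v) (x - y))"
    by (simp add: null_cross_commute)
qed auto

lemma card_cross_fibre_le:
  assumes "prime p" "separated p S" "\<not> null p u"
  shows "card {v \<in> cube S. null p (cross u v - w)} \<le> card S"
proof (rule card_parallel_le[OF assms])
  fix x y
  assume x: "x \<in> {v \<in> cube S. null p (cross u v - w)}"
    and y: "y \<in> {v \<in> cube S. null p (cross u v - w)}"
  have "null p ((cross u x - w) - (cross u y - w))"
    using x y unfolding mem_Collect_eq by (metis null_diff)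
  then show "null p (cross u (x - y))" by (simp add: cross_diff_right)
qed auto

section \<open>Exact size of planes over the full residue system\<close>

lemma separated_residues: "separated p {0..<p}"
proof -
  have "x = y" if "x \<in> {0..<p}" "y \<in> {0..<p}" "p dvd x - y" for x y
  proof -
    have "x mod p = y mod p" using that(3) by (simp add: mod_eq_dvd_iff)
    with that show ?thesis by simp
  qed
  then show ?thesis by (simp add: separated_def)
qed

text \<open>The \<open>p\<close> parallel planes partition \<open>p ^ 3\<close> points and each has
  at most \<open>p ^ 2\<close> of them, so none can have fewer.\<close>

lemma card_residue_plane:
  assumes "prime p" "\<not> null p v"
  shows "card {w \<in> cube {0..<p}. p dvd dot v w - t} = nat p ^ 2"
proof -
  have p: "p > 0" using assms(1) prime_gt_0_int by blast
  let ?W = "cube {0..<p}"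
  let ?c = "\<lambda>t. card {w \<in> ?W. p dvd dot v w - t}"
  have le: "?c t \<le> nat p ^ 2" for t
    using card_plane_le[OF assms(1) separated_residues assms(2), of t] by simp
  have cong: "?c t = ?c (t mod p)"
    by (simp add: mod_eq_dvd_iff[symmetric])
  have "(\<Sum>t\<in>{0..<p}. ?c t) = card (\<Union>t\<in>{0..<p}. {w \<in> ?W. p dvd dot v w - t})"
  proof (rule card_UN_disjoint[symmetric])
    show "\<forall>i\<in>{0..<p}. \<forall>j\<in>{0..<p}. i \<noteq> j \<longrightarrow>
        {w \<in> ?W. p dvd dot v w - i} \<inter> {w \<in> ?W. p dvd dot v w - j} = {}"
      by (auto simp: mod_eq_dvd_iff[symmetric])
  qed auto
  also have "(\<Union>t\<in>{0..<p}. {w \<in> ?W. p dvd dot v w - t}) = ?W"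
  proof -
    have "\<exists>t\<in>{0..<p}. p dvd dot v w - t" for w
      using p by (intro bexI[of _ "dot v w mod p"]) (auto simp: mod_eq_dvd_iff[symmetric])
    then show ?thesis by auto
  qed
  also have "card ?W = nat p ^ 3" by (simp add: card_cube)
  finally have total: "(\<Sum>t\<in>{0..<p}. ?c t) = nat p ^ 3" .
  show ?thesis
  proof (rule ccontr)
    assume "?c t \<noteq> nat p ^ 2"
    then have "?c (t mod p) < nat p ^ 2" using le[of t] cong by linarith
    then have "(\<Sum>t\<in>{0..<p}. ?c t) < (\<Sum>t\<in>{0..<p}. nat p ^ 2)"
      using le p by (intro sum_strict_mono_ex1) (auto intro!: bexI[of _ "t mod p"])
    also have "\<dots> = nat p ^ 3" by (simp add: power2_eq_square power3_eq_cube)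
    finally show False using total by simp
  qed
qed

subsection \<open>Points of the box on a plane: second moments\<close>

text \<open>With \<open>0 \<in> S\<close>, the zero vector is the unique null vector of the box, so
  each moment has exactly one exceptional vector.\<close>

locale prime_box =
  fixes p :: int and S :: "int set"
  assumes p: "prime p" and S: "separated p S" and S0: "0 \<in> S"
begin

abbreviation V :: "vec set" where "V \<equiv> cube S"
abbreviation W :: "vec set" where "W \<equiv> cube {0..<p}"
abbreviation N :: real where "N \<equiv> real (card S)"
abbreviation q :: real where "q \<equiv> real_of_int p"
abbreviation \<mu> :: real where "\<mu> \<equiv> N ^ 3 / q"

text \<open>Written as a sum of indicators so that its powers expand into multiple sums that can be
  interchanged.\<close>

definition M :: "int \<Rightarrow> vec \<Rightarrow> real" where
  "M t w = (\<Sum>v\<in>V. of_bool (p dvd dot v w - t))"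

definition D :: real where
  "D = (\<Sum>u\<in>V. \<Sum>v\<in>V. of_bool (null p (cross u v)))"

lemma finite_S: "finite S" using S by (simp add: separated_def)

lemma finite_V: "finite V" using finite_S by simp

lemma p_gt: "p > 1" using p by (rule prime_gt_1_int)

lemma q_gt: "q > 1" using p_gt by simp

lemma real_card_V: "real (card V) = N ^ 3" by (simp add: card_cube)

lemma zero_V: "0 \<in> V" using S0 by (simp add: cube_def zero_prod_def)

lemma null_V: "v \<in> V \<Longrightarrow> null p v \<longleftrightarrow> v = 0"
  using null_diff_cube_imp_eq[OF S _ zero_V, of v] by (cases v) (auto simp: zero_prod_def)

lemma sum_of_bool_card:
  "finite A \<Longrightarrow> (\<Sum>x\<in>A. of_bool (P x) :: real) = real (card {x \<in> A. P x})"
  by (simp add: of_bool_def sum.If_cases Int_def conj_commute)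

lemma M_nonneg: "M t w \<ge> 0" by (simp add: M_def sum_nonneg)

lemma M_eq_card: "M t w = real (card {v \<in> V. p dvd dot v w - t})"
  unfolding M_def by (rule sum_of_bool_card) (rule finite_V)

lemma M_le: "\<not> null p w \<Longrightarrow> M t w \<le> N ^ 2"
proof -
  assume "\<not> null p w"
  from card_plane_le[OF p S this, of t] show ?thesis
    unfolding M_eq_card dot_commute[of _ w] by (metis of_nat_le_iff of_nat_power)
qed

lemma real_card_W: "real (card W) = q ^ 3"
  using p_gt by (simp add: card_cube)

lemma sum_plane:
  assumes "v \<in> V" "v \<noteq> 0"
  shows "(\<Sum>w\<in>W. of_bool (p dvd dot v w - t)) = q ^ 2"
proof -
  have "\<not> null p v" using assms null_V by simp
  have "finite W" by simp
  then have "(\<Sum>w\<in>W. of_bool (p dvd dot v w - t)) = real (card {w \<in> W. p dvd dot v w - t})"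
    by (rule sum_of_bool_card)
  also have "\<dots> = q ^ 2"
    using card_residue_plane[OF p \<open>\<not> null p v\<close>, of t] p_gt by simp
  finally show ?thesis .
qed

lemma sum_line:
  assumes "\<not> null p (cross u v)"
  shows "(\<Sum>w\<in>W. of_bool (p dvd dot u w - s \<and> p dvd dot v w - t)) \<le> q"
proof -
  have "finite W" by simp
  then have "(\<Sum>w\<in>W. of_bool (p dvd dot u w - s \<and> p dvd dot v w - t)) =
      real (card {w \<in> W. p dvd dot u w - s \<and> p dvd dot v w - t})"
    by (rule sum_of_bool_card)
  also have "\<dots> \<le> real (card {0..<p})"
    using card_line_le[OF p separated_residues assms, of s t] by (intro of_nat_mono)
  also have "\<dots> = q" using p_gt by simp
  finally show ?thesis .
qed

text \<open>Every nonzero \<open>v\<close> contributes exactly \<open>q ^ 2\<close>. The vector 0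
  contributes all of \<open>W\<close> or nothing, according to whether \<open>p\<close> divides
  \<open>t\<close>.\<close>

lemma sum_M: "(\<Sum>w\<in>W. M t w) = (\<Sum>w\<in>W. of_bool (p dvd t)) + (N ^ 3 - 1) * q ^ 2"
proof -
  have "(\<Sum>w\<in>W. M t w) = (\<Sum>v\<in>V. \<Sum>w\<in>W. of_bool (p dvd dot v w - t))"
    unfolding M_def by (rule sum.swap)
  also have "\<dots> = (\<Sum>w\<in>W. of_bool (p dvd dot 0 w - t)) + (\<Sum>v\<in>V-{0}. \<Sum>w\<in>W. of_bool (p dvd dot v w - t))"
    by (rule sum.remove[OF finite_V zero_V])
  also have "(\<Sum>v\<in>V-{0}. \<Sum>w\<in>W. of_bool (p dvd dot v w - t)) = (\<Sum>v\<in>V-{0}. q ^ 2)"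
    by (intro sum.cong refl sum_plane) auto
  also have "\<dots> = (N ^ 3 - 1) * q ^ 2"
  proof -
    have "card V \<ge> 1" using finite_V zero_V by (auto simp: Suc_le_eq card_gt_0_iff)
    then have "real (card (V - {0})) = N ^ 3 - 1"
      using real_card_V zero_V by (simp only: card_Diff_singleton of_nat_diff of_nat_1)
    then show ?thesis by simp
  qed
  also have "dot 0 = (\<lambda>w. 0)" by (auto simp: fun_eq_iff zero_prod_def)
  finally show ?thesis by simp
qed

lemma sum_M_square:
  "(\<Sum>w\<in>W. (M t w)\<^sup>2) =
    (\<Sum>u\<in>V. \<Sum>v\<in>V. \<Sum>w\<in>W. of_bool (p dvd dot u w - t \<and> p dvd dot v w - t))"
proof -
  have "(M t w)\<^sup>2 = (\<Sum>u\<in>V. \<Sum>v\<in>V. of_bool (p dvd dot u w - t \<and> p dvd dot v w - t))" for w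
    unfolding M_def power2_eq_square sum_product by (simp add: of_bool_conj)
  then have "(\<Sum>w\<in>W. (M t w)\<^sup>2) =
      (\<Sum>w\<in>W. \<Sum>u\<in>V. \<Sum>v\<in>V. of_bool (p dvd dot u w - t \<and> p dvd dot v w - t))"
    by simp
  also have "\<dots> = (\<Sum>u\<in>V. \<Sum>w\<in>W. \<Sum>v\<in>V. of_bool (p dvd dot u w - t \<and> p dvd dot v w - t))"
    by (rule sum.swap)
  also have "\<dots> = (\<Sum>u\<in>V. \<Sum>v\<in>V. \<Sum>w\<in>W. of_bool (p dvd dot u w - t \<and> p dvd dot v w - t))"
    by (intro sum.cong refl sum.swap)
  finally show ?thesis .
qed

lemma variance_expand:
  "(\<Sum>w\<in>W. (M t w - \<mu>)\<^sup>2) = (\<Sum>w\<in>W. (M t w)\<^sup>2) - 2 * \<mu> * (\<Sum>w\<in>W. M t w) + N ^ 6 * q"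
proof -
  have "(\<Sum>w\<in>W. (M t w - \<mu>)\<^sup>2) = (\<Sum>w\<in>W. (M t w)\<^sup>2 - 2 * \<mu> * M t w + \<mu>\<^sup>2)"
    by (simp add: power2_diff algebra_simps)
  also have "\<dots> = (\<Sum>w\<in>W. (M t w)\<^sup>2) - 2 * \<mu> * (\<Sum>w\<in>W. M t w) + q ^ 3 * \<mu>\<^sup>2"
    using real_card_W
    by (simp only: sum.distrib sum_subtractf sum_distrib_left[symmetric]) simp
  also have "q ^ 3 * \<mu>\<^sup>2 = N ^ 6 * q"
    using q_gt by (simp add: field_simps eval_nat_numeral)
  finally show ?thesis .
qed

text \<open>In the second moment, pairs bounded by \<open>q\<close> add up to
  \<open>N ^ 6 * q\<close>, which cancels against the mean terms. Distinct parallel pairs contribute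
  nothing because \<open>t\<close> is invertible, so only the diagonal \<open>N ^ 3 * q ^ 2\<close>
  and the correction \<open>2 * N ^ 3 * q\<close> from the zero vector survive.\<close>

lemma variance_nonzero:
  assumes t: "\<not> p dvd t"
  shows "(\<Sum>w\<in>W. (M t w - \<mu>)\<^sup>2) \<le> 3 * q ^ 2 * N ^ 3"
proof -
  have pair: "(\<Sum>w\<in>W. of_bool (p dvd dot u w - t \<and> p dvd dot v w - t)) \<le> q + of_bool (u = v) * q ^ 2"
    if uv: "u \<in> V" "v \<in> V" for u v
  proof (cases "null p (cross u v)")
    case False
    from sum_line[OF this, of t t] show ?thesis by (smt (verit) of_bool_def zero_le_power2 mult_nonneg_nonneg)
  next
    case null: True
    show ?thesis
    proof (cases "u = v")
      case True
      show ?thesis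
      proof (cases "u = 0")
        case True
        then have "dot u w = 0" for w by (cases w) (simp add: zero_prod_def)
        then show ?thesis using t q_gt \<open>u = v\<close> by simp
      next
        case False
        then show ?thesis using sum_plane[OF uv(1), of t] \<open>u = v\<close> q_gt by simp
      qed
    next
      case False
      have empty: "(p dvd dot u w - t \<and> p dvd dot v w - t) = False" for w
      proof -
        have "\<not> (p dvd dot u w - t \<and> p dvd dot v w - t)"
        proof
          assume a: "p dvd dot u w - t \<and> p dvd dot v w - t"
          \<comment> \<open>If \<open>w\<close> has product \<open>t\<close> with both
            \<open>u\<close> and \<open>v\<close>, and these are parallel, all three terms on the
            right are null; dividing by \<open>t\<close> gives \<open>u = v\<close>.\<close>
          have e: "scale t (u - v) = scale (dot w u - t) v - scale (dot w v - t) u + cross w (cross u v)"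
            unfolding cross_cross
            by (cases u; cases v; cases w) (simp add: algebra_simps)
          have "null p (scale t (u - v))" unfolding e
          proof -
            have add: "null p (x - y + z)" if "null p x" "null p y" "null p z" for x y z
              using that by (cases x; cases y; cases z) auto
            have cr: "null p (cross w z)" if "null p z" for z
              using that by (cases w; cases z) auto
            show "null p (scale (dot w u - t) v - scale (dot w v - t) u + cross w (cross u v))"
              using a null by (intro add cr null_scale) (auto simp: dot_commute[of w])
          qed
          then have "null p (u - v)" using null_scaleD[OF p] t by blast
          with null_diff_cube_imp_eq[OF S uv] False show False by blast
        qed
        then show ?thesis by simp
      qed
      show ?thesis unfolding empty using q_gt by simp
    qed
  qed
  have "(\<Sum>w\<in>W. (M t w)\<^sup>2) \<le> (\<Sum>u\<in>V. \<Sum>v\<in>V. q + of_bool (u = v) * q ^ 2)"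
    unfolding sum_M_square by (intro sum_mono pair)
  also have "\<dots> = N ^ 6 * q + N ^ 3 * q ^ 2"
  proof -
    have "(\<Sum>v\<in>V. q + of_bool (u = v) * q ^ 2) = N ^ 3 * q + q ^ 2" if "u \<in> V" for u
    proof -
      have "(\<Sum>v\<in>V. of_bool (u = v) * q ^ 2) = (\<Sum>v\<in>V. if u = v then q ^ 2 else 0)"
        by (intro sum.cong) auto
      also have "\<dots> = q ^ 2" using that finite_V by simp
      finally show ?thesis using real_card_V by (simp add: sum.distrib)
    qed
    then have "(\<Sum>u\<in>V. \<Sum>v\<in>V. q + of_bool (u = v) * q ^ 2) = N ^ 3 * (N ^ 3 * q + q ^ 2)"
      using real_card_V by simp
    then show ?thesis by (simp add: algebra_simps)
  qed
  finally have sq: "(\<Sum>w\<in>W. (M t w)\<^sup>2) \<le> N ^ 6 * q + N ^ 3 * q ^ 2" .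
  have "2 * \<mu> * (\<Sum>w\<in>W. M t w) = 2 * N ^ 6 * q - 2 * N ^ 3 * q"
    unfolding sum_M using t q_gt by (simp add: field_simps power2_eq_square)
  with sq have "(\<Sum>w\<in>W. (M t w - \<mu>)\<^sup>2) \<le> N ^ 3 * q ^ 2 + 2 * (N ^ 3 * q)"
    unfolding variance_expand by linarith
  also have "N ^ 3 * q \<le> N ^ 3 * q ^ 2"
    using q_gt by (intro mult_left_mono) (auto simp: power2_eq_square)
  finally show ?thesis by (simp add: algebra_simps)
qed

text \<open>The main terms cancel as for nonzero \<open>t\<close>, but now every parallel pair may
  share a whole plane of \<open>q ^ 2\<close> vectors, and the pair of zero vectors is orthogonal to
  all \<open>q ^ 3\<close>.\<close>

lemma variance_zero: "(\<Sum>w\<in>W. (M 0 w - \<mu>)\<^sup>2) \<le> q ^ 2 * D + q ^ 3"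
proof -
  have pair: "(\<Sum>w\<in>W. of_bool (p dvd dot u w - 0 \<and> p dvd dot v w - 0))
      \<le> q + of_bool (null p (cross u v)) * q ^ 2 + of_bool (u = 0) * of_bool (v = 0) * q ^ 3"
    if uv: "u \<in> V" "v \<in> V" for u v
  proof (cases "null p (cross u v)")
    case False
    from sum_line[OF this, of 0 0] False q_gt show ?thesis
      by (smt (verit) of_bool_def zero_le_power2 mult_nonneg_nonneg zero_le_power)
  next
    case null: True
    consider "u \<noteq> 0" | "v \<noteq> 0" | "u = 0" "v = 0" by blast
    then show ?thesis
    proof cases
      case 1
      have "(\<Sum>w\<in>W. of_bool (p dvd dot u w - 0 \<and> p dvd dot v w - 0)) \<le> (\<Sum>w\<in>W. of_bool (p dvd dot u w - 0) :: real)"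
        by (intro sum_mono) auto
      also have "\<dots> = q ^ 2" by (rule sum_plane[OF uv(1) 1])
      finally show ?thesis
        by (rule order_trans) (use null q_gt in \<open>simp add: add_increasing\<close>)
    next
      case 2
      have "(\<Sum>w\<in>W. of_bool (p dvd dot u w - 0 \<and> p dvd dot v w - 0)) \<le> (\<Sum>w\<in>W. of_bool (p dvd dot v w - 0) :: real)"
        by (intro sum_mono) auto
      also have "\<dots> = q ^ 2" by (rule sum_plane[OF uv(2) 2])
      finally show ?thesis
        by (rule order_trans) (use null q_gt in \<open>simp add: add_increasing\<close>)
    next
      case 3
      have "(\<Sum>w\<in>W. of_bool (p dvd dot u w - 0 \<and> p dvd dot v w - 0)) \<le> (\<Sum>w\<in>W. 1 :: real)"
        by (intro sum_mono) auto
      also have "\<dots> = q ^ 3" using real_card_W by simp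
      finally show ?thesis
        by (rule order_trans) (use 3 q_gt in \<open>simp add: add_increasing\<close>)
    qed
  qed
  have "(\<Sum>w\<in>W. (M 0 w)\<^sup>2) \<le> (\<Sum>u\<in>V. \<Sum>v\<in>V. q + of_bool (null p (cross u v)) * q ^ 2 + of_bool (u = 0) * of_bool (v = 0) * q ^ 3)"
    unfolding sum_M_square by (intro sum_mono pair)
  also have "\<dots> = N ^ 6 * q + D * q ^ 2 + q ^ 3"
  proof -
    have "(\<Sum>u\<in>V. \<Sum>v\<in>V. of_bool (u = 0) * of_bool (v = 0) * q ^ 3) = (\<Sum>u\<in>V. of_bool (u = 0) :: real) * (\<Sum>v\<in>V. of_bool (v = 0)) * q ^ 3"
      by (simp only: sum_product) (simp only: sum_distrib_right)
    also have "(\<Sum>u\<in>V. of_bool (u = 0) :: real) = 1"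
      using finite_V zero_V unfolding of_bool_def by (subst sum.delta) auto
    finally have z: "(\<Sum>u\<in>V. \<Sum>v\<in>V. of_bool (u = 0) * of_bool (v = 0) * q ^ 3) = q ^ 3" by simp
    have n: "(\<Sum>u\<in>V. \<Sum>v\<in>V. of_bool (null p (cross u v)) * q ^ 2) = D * q ^ 2"
      by (simp only: D_def sum_distrib_right)
    show ?thesis
      unfolding sum.distrib z n using real_card_V by simp
  qed
  finally have sq: "(\<Sum>w\<in>W. (M 0 w)\<^sup>2) \<le> N ^ 6 * q + D * q ^ 2 + q ^ 3" .
  have "2 * \<mu> * (\<Sum>w\<in>W. M 0 w) = 2 * N ^ 6 * q + 2 * N ^ 3 * (q ^ 2 - q)"
    unfolding sum_M using q_gt real_card_W
    by (simp add: field_simps power2_eq_square power3_eq_cube[of q])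
  moreover have "N ^ 3 * (q ^ 2 - q) \<ge> 0" using q_gt by (simp add: power2_eq_square)
  ultimately show ?thesis
    unfolding variance_expand using sq mult.commute[of D "q ^ 2"] by linarith
qed

end

subsection \<open>Singular matrices and the deviation from the mean\<close>

text \<open>Grouping by the value of \<open>g\<close> gives a sum weighted by fibre sizes. The sum
  of squared fibre sizes equals the sum over \<open>x\<close> of the size of the fibre through
  \<open>x\<close>, which is the form that can be bounded pointwise.\<close>

lemma fibre_Cauchy_Schwarz:
  fixes f :: "'b \<Rightarrow> real"
  assumes G: "finite G" and X: "finite X" and g: "g ` G \<subseteq> X"
  shows "(\<Sum>x\<in>G. f (g x))\<^sup>2 \<le> (\<Sum>x\<in>G. real (card {y \<in> G. g y = g x})) * (\<Sum>w\<in>X. (f w)\<^sup>2)"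
proof -
  let ?c = "\<lambda>w. real (card {x \<in> G. g x = w})"
  have 1: "(\<Sum>x\<in>G. f (g x)) = (\<Sum>w\<in>X. ?c w * f w)"
  proof -
    have "(\<Sum>x\<in>G. f (g x)) = (\<Sum>w\<in>X. \<Sum>x\<in>{x \<in> G. g x = w}. f (g x))"
      by (rule sum.group[OF G X g, symmetric])
    also have "\<dots> = (\<Sum>w\<in>X. \<Sum>x\<in>{x \<in> G. g x = w}. f w)" by (intro sum.cong) auto
    finally show ?thesis by simp
  qed
  have 2: "(\<Sum>x\<in>G. ?c (g x)) = (\<Sum>w\<in>X. (?c w)\<^sup>2)"
  proof -
    have "(\<Sum>x\<in>G. ?c (g x)) = (\<Sum>w\<in>X. \<Sum>x\<in>{x \<in> G. g x = w}. ?c (g x))"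
      by (rule sum.group[OF G X g, symmetric])
    also have "\<dots> = (\<Sum>w\<in>X. \<Sum>x\<in>{x \<in> G. g x = w}. ?c w)" by (intro sum.cong) auto
    finally show ?thesis by (simp add: power2_eq_square)
  qed
  show ?thesis
    unfolding 1 2 by (rule Cauchy_Schwarz_ineq_sum)
qed

lemma null_red_iff: "p > 0 \<Longrightarrow> red p x = red p y \<longleftrightarrow> null p (x - y)"
  by (cases x; cases y) (simp add: mod_eq_dvd_iff)

lemma null_diff_red: "null p (red p w - w)"
  by (cases w) (simp add: mod_eq_dvd_iff[symmetric])

lemma red_in_cube: "p > 0 \<Longrightarrow> red p w \<in> cube {0..<p}"
  by (cases w) (simp add: cube_def)

context prime_box
begin

definition G :: "(vec \<times> vec) set" where
  "G = {x \<in> V \<times> V. \<not> null p (cross (fst x) (snd x))}"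

definition T :: real where
  "T = (\<Sum>x\<in>G. \<Sum>r\<in>V. of_bool (p dvd dot r (cross (fst x) (snd x))))"

lemma T_nonneg: "T \<ge> 0"
  unfolding T_def by (intro sum_nonneg) auto

lemma finite_G: "finite G" by (simp add: G_def finite_V)

lemma M_red: "M t (red p w) = M t w"
proof -
  have "p dvd dot v (red p w) - t \<longleftrightarrow> p dvd dot v w - t" for v
  proof -
    have "p dvd dot v (red p w - w)"
      using null_dot[OF null_diff_red] dot_commute by metis
    then have "p dvd dot v (red p w) - dot v w" by (simp add: dot_diff_right)
    then show ?thesis by (metis mod_eq_dvd_iff)
  qed
  then show ?thesis by (simp add: M_def)
qed

text \<open>If \<open>(r, v)\<close> lies in the fibre of \<open>w\<close>, then \<open>r\<close> is
  orthogonal to \<open>w\<close>, and for given \<open>r\<close> the candidates for \<open>v\<close>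
  lie on one line, with at most \<open>N\<close> points. Counting the admissible \<open>r\<close>
  over all \<open>x\<close> gives \<open>T\<close>.\<close>

lemma sum_card_fibres_le: 
  "(\<Sum>x\<in>G. real (card {y \<in> G. red p (cross (fst y) (snd y)) = red p (cross (fst x) (snd x))})) \<le> N * T"
proof -
  have "real (card {y \<in> G. red p (cross (fst y) (snd y)) = red p (cross (fst x) (snd x))})
      \<le> N * (\<Sum>r\<in>V. of_bool (p dvd dot r (cross (fst x) (snd x))))" if x: "x \<in> G" for x
  proof -
    define w where "w = cross (fst x) (snd x)"
    have w: "\<not> null p w" using x by (simp add: G_def w_def)
    have pp: "p > 0" using p_gt by simp
    let ?R = "{r \<in> V. \<not> null p r \<and> p dvd dot r w}"
    let ?A = "\<lambda>r. {v \<in> V. null p (cross r v - w)}"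
    have sub: "{y \<in> G. red p (cross (fst y) (snd y)) = red p w} \<subseteq> (SIGMA r:?R. ?A r)"
    proof
      fix y assume y: "y \<in> {y \<in> G. red p (cross (fst y) (snd y)) = red p w}"
      obtain r v where rv: "y = (r, v)" by (cases y)
      have n: "null p (cross r v - w)" using y rv null_red_iff[OF pp] by auto
      have "\<not> null p r"
      proof
        assume "null p r"
        then have "null p (cross r v)" by (cases r; cases v) auto
        then show False using y rv by (simp add: G_def)
      qed
      moreover have "p dvd dot r w"
      proof -
        have "p dvd dot (cross r v - w) r" by (rule null_dot[OF n])
        then show ?thesis
          by (simp add: dot_diff_left dot_commute[of "cross r v"] dot_cross_self dot_commute[of w])
      qed
      ultimately show "y \<in> (SIGMA r:?R. ?A r)" using y rv n by (auto simp: G_def)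
    qed
    have "card {y \<in> G. red p (cross (fst y) (snd y)) = red p w} \<le> card (SIGMA r:?R. ?A r)"
      using finite_V by (intro card_mono sub) auto
    also have "\<dots> = (\<Sum>r\<in>?R. card (?A r))" using finite_V by simp
    also have "\<dots> \<le> (\<Sum>r\<in>?R. card S)"
      by (intro sum_mono card_cross_fibre_le[OF p S]) auto
    also have "\<dots> = card S * card ?R" by simp
    also have "\<dots> \<le> card S * card {r \<in> V. p dvd dot r w}"
      using finite_V by (intro mult_left_mono card_mono) auto
    finally have "real (card {y \<in> G. red p (cross (fst y) (snd y)) = red p w})
        \<le> real (card S * card {r \<in> V. p dvd dot r w})" by (rule of_nat_mono)
    also have "\<dots> = N * (\<Sum>r\<in>V. of_bool (p dvd dot r w))"
      unfolding sum_of_bool_card[OF finite_V] by (rule of_nat_mult)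
    finally show ?thesis unfolding w_def .
  qed
  then show ?thesis unfolding T_def sum_distrib_left by (intro sum_mono)
qed

text \<open>On parallel pairs \<open>M t\<close> vanishes, so each deviates by exactly
  \<open>- \<mu>\<close>; this is the term \<open>\<mu> * D\<close>. On \<open>G\<close>,
  Cauchy-Schwarz combines the fibre bound \<open>N * T\<close> with the variance for nonzero
  \<open>t\<close>.\<close>

lemma count_deviation:
  assumes t: "\<not> p dvd t"
  shows "\<bar>(\<Sum>x\<in>V \<times> V. M t (cross (fst x) (snd x))) - N ^ 9 / q\<bar>
    \<le> sqrt (3 * q ^ 2 * N ^ 4 * T) + \<mu> * D"
proof -
  let ?f = "\<lambda>w. M t w - \<mu>" and ?c = "\<lambda>x. cross (fst x) (snd x)"
  \<comment> \<open>Reducing the cross product changes no value of \<open>M t\<close> and moves the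
    argument into \<open>W\<close>, the range of the variance.\<close>
  define F where "F = (\<Sum>x\<in>G. ?f (red p (?c x)))"
  have "F\<^sup>2 \<le> (\<Sum>x\<in>G. real (card {y \<in> G. red p (?c y) = red p (?c x)})) * (\<Sum>w\<in>W. (?f w)\<^sup>2)"
    unfolding F_def
  proof (rule fibre_Cauchy_Schwarz[OF finite_G])
    show "(\<lambda>x. red p (?c x)) ` G \<subseteq> W"
      using p_gt by (intro image_subsetI red_in_cube) simp
  qed simp
  also have "\<dots> \<le> (N * T) * (3 * q ^ 2 * N ^ 3)"
    using q_gt by (intro mult_mono sum_card_fibres_le variance_nonzero[OF t] sum_nonneg)
      (simp_all add: T_nonneg)
  also have "\<dots> = 3 * q ^ 2 * N ^ 4 * T" by (simp add: eval_nat_numeral)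
  finally have F: "\<bar>F\<bar> \<le> sqrt (3 * q ^ 2 * N ^ 4 * T)"
    by (metis real_sqrt_abs real_sqrt_le_mono)
  have D: "D = (\<Sum>x\<in>V \<times> V - G. 1)"
  proof -
    have "D = (\<Sum>x\<in>V \<times> V. of_bool (null p (?c x)))"
      unfolding D_def by (simp only: sum.cartesian_product case_prod_unfold)
    also have "\<dots> = real (card {x \<in> V \<times> V. null p (?c x)})"
      using finite_V by (intro sum_of_bool_card) auto
    also have "{x \<in> V \<times> V. null p (?c x)} = V \<times> V - G" by (auto simp: G_def)
    finally show ?thesis by simp
  qed
  have M0: "M t w = 0" if "null p w" for w
  proof -
    have "\<not> p dvd dot v w - t" for v
      using null_dot[OF that, of v] t by (simp add: dot_commute dvd_diff_right_iff)
    then show ?thesis by (simp add: M_def)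
  qed
  have "(\<Sum>x\<in>V \<times> V. ?f (?c x)) = (\<Sum>x\<in>V \<times> V - G. ?f (?c x)) + (\<Sum>x\<in>G. ?f (?c x))"
    using finite_V by (intro sum.subset_diff) (auto simp: G_def)
  also have "(\<Sum>x\<in>G. ?f (?c x)) = F" by (simp add: F_def M_red)
  also have "(\<Sum>x\<in>V \<times> V - G. ?f (?c x)) = (\<Sum>x\<in>V \<times> V - G. - \<mu> * 1)"
    by (intro sum.cong) (auto simp: G_def M0)
  also have "\<dots> = - \<mu> * D" by (simp only: D sum_distrib_left[symmetric])
  also have "(\<Sum>x\<in>V \<times> V. ?f (?c x)) = (\<Sum>x\<in>V \<times> V. M t (?c x)) - N ^ 9 / q"
  proof -
    have "real (card (V \<times> V)) * \<mu> = N ^ 9 / q"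
      by (simp add: card_cartesian_product card_cube)
    then show ?thesis by (simp only: sum_subtractf sum_constant)
  qed
  finally have "(\<Sum>x\<in>V \<times> V. M t (?c x)) - N ^ 9 / q = - \<mu> * D + F" .
  moreover have "\<mu> * D \<ge> 0" using q_gt by (auto simp: D intro!: mult_nonneg_nonneg)
  ultimately show ?thesis using F by linarith
qed

section \<open>Singular matrices through the third moment\<close>

text \<open>The right side counts triples from the box together with a nonzero \<open>w\<close>
  orthogonal to all three. A singular triple counted by \<open>T\<close> admits at least
  \<open>q - 1\<close> such \<open>w\<close>.\<close>

lemma cubic_moment_ge: "(q - 1) * T \<le> (\<Sum>w\<in>W-{0}. M 0 w ^ 3)"
proof -
  have pt: "q - 1 \<le> (\<Sum>w\<in>W-{0}. of_bool (p dvd dot u w) * of_bool (p dvd dot v w) * of_bool (p dvd dot r w))"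
    if uv: "\<not> null p (cross u v)" and r: "p dvd dot r (cross u v)" for u v r
  proof -
    let ?c = "cross u v"
    let ?X = "{w \<in> W-{0}. p dvd dot u w \<and> p dvd dot v w \<and> p dvd dot r w}"
    \<comment> \<open>The annihilating vectors are the residues of the nonzero multiples of
      \<open>cross u v\<close>.\<close>
    let ?h = "\<lambda>s. red p (scale s ?c)"
    have pp: "p > 0" using p_gt by simp
    have "card {1..<p} \<le> card ?X"
    proof (rule card_inj_on_le)
      show "inj_on ?h {1..<p}"
      proof (rule inj_onI)
        fix s s' assume s: "s \<in> {1..<p}" "s' \<in> {1..<p}" "?h s = ?h s'"
        have "null p (scale s ?c - scale s' ?c)" using s(3) null_red_iff[OF pp] by blast
        also have "scale s ?c - scale s' ?c = scale (s - s') ?c"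
          by (cases ?c) (simp add: algebra_simps)
        finally have "p dvd s - s'" using null_scaleD[OF p] uv by blast
        moreover have "s \<in> {0..<p}" "s' \<in> {0..<p}" using s by auto
        ultimately show "s = s'" using separated_residues unfolding separated_def by blast
      qed
      show "?h ` {1..<p} \<subseteq> ?X"
      proof (rule image_subsetI)
        fix s assume s: "s \<in> {1..<p}"
        have W: "?h s \<in> W" by (rule red_in_cube[OF pp])
        have ort: "p dvd dot x (?h s)" if "p dvd dot x ?c" for x
        proof -
          have "p dvd dot (?h s - scale s ?c) x" by (rule null_dot[OF null_diff_red])
          moreover have "dot x (scale s ?c) = s * dot x ?c"
            by (cases x; cases ?c) (simp add: algebra_simps)
          ultimately show ?thesis using that
            by (metis diff_add_cancel dot_commute dot_diff_left dvd_add dvd_mult)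
        qed
        have orts: "p dvd dot u (?h s)" "p dvd dot v (?h s)" "p dvd dot r (?h s)"
          using r by (intro ort; simp only: dot_cross_self dvd_0_right)+
        have "?h s \<noteq> 0"
        proof
          assume z: "?h s = 0"
          have "null p (?h s - scale s ?c)" by (rule null_diff_red)
          then have "null p (scale s ?c)" unfolding z by (cases "scale s ?c") (simp add: zero_prod_def)
          then have "p dvd s" using null_scaleD[OF p] uv by blast
          then show False using s zdvd_imp_le[of p s] by simp
        qed
        with W orts show "?h s \<in> ?X" by blast
      qed
    qed auto
    moreover have "real (card {1..<p}) = q - 1" using p_gt by simp
    moreover have "(\<Sum>w\<in>W-{0}. of_bool (p dvd dot u w) * of_bool (p dvd dot v w) * of_bool (p dvd dot r w)) = real (card ?X)"
    proof -
      have "finite (W - {0})" by simp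
      from sum_of_bool_card[OF this, of "\<lambda>w. p dvd dot u w \<and> p dvd dot v w \<and> p dvd dot r w"]
      show ?thesis by (simp only: of_bool_conj mult.assoc)
    qed
    ultimately show ?thesis by linarith
  qed
  have "(q - 1) * T = (\<Sum>x\<in>G. \<Sum>r\<in>V. (q - 1) * of_bool (p dvd dot r (cross (fst x) (snd x))))"
    by (simp only: T_def sum_distrib_left)
  also have "\<dots> \<le> (\<Sum>x\<in>G. \<Sum>r\<in>V. \<Sum>w\<in>W-{0}. of_bool (p dvd dot (fst x) w) * of_bool (p dvd dot (snd x) w) * of_bool (p dvd dot r w))"
  proof (intro sum_mono)
    fix x r assume "x \<in> G" "r \<in> V"
    show "(q - 1) * of_bool (p dvd dot r (cross (fst x) (snd x))) \<le>
      (\<Sum>w\<in>W-{0}. of_bool (p dvd dot (fst x) w) * of_bool (p dvd dot (snd x) w) * of_bool (p dvd dot r w))"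
    proof (cases "p dvd dot r (cross (fst x) (snd x))")
      case True
      then show ?thesis using pt[of "fst x" "snd x" r] \<open>x \<in> G\<close> by (simp add: G_def)
    next
      case False
      have "0 \<le> (\<Sum>w\<in>W-{0}. of_bool (p dvd dot (fst x) w) * of_bool (p dvd dot (snd x) w) * of_bool (p dvd dot r w) :: real)"
        by (intro sum_nonneg) auto
      with False show ?thesis by (simp only: of_bool_eq mult_zero_right)
    qed
  qed
  also have "\<dots> \<le> (\<Sum>x\<in>V \<times> V. \<Sum>r\<in>V. \<Sum>w\<in>W-{0}. of_bool (p dvd dot (fst x) w) * of_bool (p dvd dot (snd x) w) * of_bool (p dvd dot r w))"
    using finite_V by (intro sum_mono2) (auto simp: G_def intro!: sum_nonneg)
  also have "\<dots> = (\<Sum>u\<in>V. \<Sum>v\<in>V. \<Sum>r\<in>V. \<Sum>w\<in>W-{0}. of_bool (p dvd dot u w) * of_bool (p dvd dot v w) * of_bool (p dvd dot r w))"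
    by (simp only: sum.cartesian_product' fst_conv snd_conv)
  also have "\<dots> = (\<Sum>w\<in>W-{0}. \<Sum>u\<in>V. \<Sum>v\<in>V. \<Sum>r\<in>V. of_bool (p dvd dot u w) * of_bool (p dvd dot v w) * of_bool (p dvd dot r w))"
    by (simp only: sum.swap[of _ _ "W - {0}"])
  also have "\<dots> = (\<Sum>w\<in>W-{0}. M 0 w ^ 3)"
    unfolding M_def power3_eq_cube diff_0_right
    by (simp only: sum_distrib_left sum_distrib_right mult.assoc)
      (simp only: mult_ac)
  finally show ?thesis .
qed

text \<open>With \<open>M 0 w = m\<close>, one has
  \<open>m\<^sup>2 \<le> 2 * \<mu>\<^sup>2 + 2 * (m - \<mu>)\<^sup>2\<close>. After multiplication
  by \<open>m\<close>, the plane bound \<open>m \<le> N\<^sup>2\<close>, valid for nonzero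
  \<open>w\<close>, is spent only on the deviation; the first moment and the variance at 0
  finish.\<close>

lemma T_bound:
  "(q - 1) * T \<le> 2 * N ^ 6 * q + 2 * N ^ 9 + 2 * N ^ 2 * (q ^ 2 * D + q ^ 3)"
proof -
  note cubic_moment_ge
  also have "(\<Sum>w\<in>W-{0}. M 0 w ^ 3) \<le> (\<Sum>w\<in>W-{0}. 2 * \<mu>\<^sup>2 * M 0 w + 2 * N\<^sup>2 * (M 0 w - \<mu>)\<^sup>2)"
  proof (rule sum_mono)
    fix w assume w: "w \<in> W - {0}"
    let ?m = "M 0 w"
    have "\<not> null p w"
    proof
      assume "null p w"
      then have "null p (w - 0)" by simp
      moreover have "(0::vec) \<in> W" using p_gt by (simp add: cube_def zero_prod_def)
      ultimately show False using null_diff_cube_imp_eq[OF separated_residues] w by blast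
    qed
    then have le: "?m \<le> N\<^sup>2" by (rule M_le)
    have "?m\<^sup>2 \<le> 2 * \<mu>\<^sup>2 + 2 * (?m - \<mu>)\<^sup>2"
    proof -
      have "2 * b\<^sup>2 + 2 * (a - b)\<^sup>2 - a\<^sup>2 = (a - 2 * b)\<^sup>2" for a b :: real
        by (simp add: power2_eq_square algebra_simps)
      then show ?thesis by (metis diff_ge_0_iff_ge zero_le_power2)
    qed
    then have "?m * ?m\<^sup>2 \<le> ?m * (2 * \<mu>\<^sup>2 + 2 * (?m - \<mu>)\<^sup>2)"
      by (rule mult_left_mono) (rule M_nonneg)
    also have "\<dots> = 2 * \<mu>\<^sup>2 * ?m + 2 * (?m * (?m - \<mu>)\<^sup>2)" by (simp only: distrib_left) (simp only: mult_ac)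
    also have "?m * (?m - \<mu>)\<^sup>2 \<le> N\<^sup>2 * (?m - \<mu>)\<^sup>2"
      by (rule mult_right_mono[OF le]) simp
    finally show "?m ^ 3 \<le> 2 * \<mu>\<^sup>2 * ?m + 2 * N\<^sup>2 * (?m - \<mu>)\<^sup>2"
      by (simp only: power3_eq_cube power2_eq_square mult.assoc)
  qed
  also have "\<dots> \<le> (\<Sum>w\<in>W. 2 * \<mu>\<^sup>2 * M 0 w + 2 * N\<^sup>2 * (M 0 w - \<mu>)\<^sup>2)"
    by (intro sum_mono2) (auto simp: M_nonneg)
  also have "\<dots> = 2 * \<mu>\<^sup>2 * (\<Sum>w\<in>W. M 0 w) + 2 * N\<^sup>2 * (\<Sum>w\<in>W. (M 0 w - \<mu>)\<^sup>2)"
    by (simp only: sum.distrib sum_distrib_left)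
  also have "\<dots> \<le> 2 * \<mu>\<^sup>2 * (q ^ 3 + N ^ 3 * q ^ 2) + 2 * N\<^sup>2 * (q ^ 2 * D + q ^ 3)"
  proof (intro add_mono mult_left_mono variance_zero)
    show "(\<Sum>w\<in>W. M 0 w) \<le> q ^ 3 + N ^ 3 * q ^ 2"
      unfolding sum_M using real_card_W by (simp add: algebra_simps)
  qed auto
  also have "2 * \<mu>\<^sup>2 * (q ^ 3 + N ^ 3 * q ^ 2) = 2 * N ^ 6 * q + 2 * N ^ 9"
    using q_gt by (simp add: field_simps eval_nat_numeral)
  finally show ?thesis by simp
qed

end

subsection \<open>Pairs of parallel vectors\<close>

definition sup_norm :: "int \<times> int \<Rightarrow> int" where
  "sup_norm v = max \<bar>fst v\<bar> \<bar>snd v\<bar>"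

text \<open>For an interval \<open>S\<close>, these are the points in a square of a plane lattice of
  index \<open>p\<close>. A congruence between \<open>v\<close> and \<open>scale c u\<close> says
  that each of the three coordinate pairs is such a point.\<close>

definition lattice_points :: "int \<Rightarrow> int set \<Rightarrow> int \<Rightarrow> (int \<times> int) set" where
  "lattice_points p S c = {v \<in> S \<times> S. p dvd snd v - c * fst v}"

lemma sup_norm_pos: "v \<noteq> 0 \<Longrightarrow> sup_norm v \<ge> 1"
  by (cases v) (auto simp: sup_norm_def zero_prod_def)

text \<open>Comparison with a telescoping sum, by induction.\<close>

lemma sum_inverse_squares_le: "n \<ge> 1 \<Longrightarrow> (\<Sum>k=1..n. 1 / real k ^ 2) \<le> 2 - 1 / real n"
proof (induction n rule: dec_induct)
  case (step n)
  have "1 / real (Suc n) ^ 2 \<le> 1 / (real n * real (Suc n))"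
    using step.hyps by (intro divide_left_mono) (auto simp: power2_eq_square)
  also have "\<dots> = 1 / real n - 1 / real (Suc n)"
    using step.hyps by (simp add: field_simps)
  finally show ?case using step by simp
qed simp

text \<open>The shell of norm \<open>s\<close> lies on the four sides of a square and has at most
  \<open>4 * (2 * s + 1) \<le> 12 * s\<close> points, which leaves the convergent sum of
  \<open>12 / s ^ 2\<close>.\<close>

lemma sum_inverse_cube_sup_norm_le:
  assumes "H \<ge> 1"
  shows "(\<Sum>v\<in>{-H..H} \<times> {-H..H} - {0}. 1 / real_of_int (sup_norm v) ^ 3) \<le> 24"
proof -
  let ?B = "{-H..H} \<times> {-H..H} - {0}"
  let ?g = "\<lambda>v. nat (sup_norm v)"
  have "(\<Sum>v\<in>?B. 1 / real_of_int (sup_norm v) ^ 3) = (\<Sum>v\<in>?B. 1 / real (?g v) ^ 3)"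
  proof (rule sum.cong)
    fix v assume "v \<in> ?B"
    then have "sup_norm v \<ge> 1" by (intro sup_norm_pos) auto
    then show "1 / real_of_int (sup_norm v) ^ 3 = 1 / real (?g v) ^ 3" by simp
  qed simp
  also have "\<dots> = (\<Sum>s\<in>{1..nat H}. \<Sum>v\<in>{v \<in> ?B. ?g v = s}. 1 / real (?g v) ^ 3)"
  proof (rule sum.group[symmetric])
    show "?g ` ?B \<subseteq> {1..nat H}"
    proof (rule image_subsetI)
      fix v assume v: "v \<in> ?B"
      then have "sup_norm v \<ge> 1" by (intro sup_norm_pos) auto
      moreover have "sup_norm v \<le> H" using v by (auto simp: sup_norm_def)
      ultimately show "?g v \<in> {1..nat H}" by auto
    qed
  qed auto
  also have "\<dots> \<le> (\<Sum>s\<in>{1..nat H}. 12 * (1 / real s ^ 2))"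
  proof (rule sum_mono)
    fix s assume s: "s \<in> {1..nat H}"
    let ?X = "{v \<in> ?B. ?g v = s}"
    let ?s = "int s"
    have sub: "?X \<subseteq> {-?s, ?s} \<times> {-?s..?s} \<union> {-?s..?s} \<times> {-?s, ?s}"
      by (auto simp: sup_norm_def max_def split: if_splits)
    have c2: "card {-?s, ?s} = 2" using s by auto
    have "card ?X \<le> card ({-?s, ?s} \<times> {-?s..?s} \<union> {-?s..?s} \<times> {-?s, ?s})"
      by (intro card_mono sub) auto
    also have "\<dots> \<le> card ({-?s, ?s} \<times> {-?s..?s}) + card ({-?s..?s} \<times> {-?s, ?s})"
      by (rule card_Un_le)
    also have "\<dots> = 4 * (2 * s + 1)"
      unfolding card_cartesian_product c2 by simp
    also have "\<dots> \<le> 12 * s" using s by simp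
    finally have "card ?X \<le> 12 * s" .
    then have c: "real (card ?X) \<le> 12 * real s" by linarith
    have "(\<Sum>v\<in>?X. 1 / real (?g v) ^ 3) = (\<Sum>v\<in>?X. 1 / real s ^ 3)" by (intro sum.cong) auto
    also have "\<dots> = real (card ?X) * (1 / real s ^ 3)" by simp
    also have "\<dots> \<le> (12 * real s) * (1 / real s ^ 3)" using c by (intro mult_right_mono) auto
    also have "\<dots> = 12 * (1 / real s ^ 2)" using s by (simp add: field_simps eval_nat_numeral)
    finally show "(\<Sum>v\<in>?X. 1 / real (?g v) ^ 3) \<le> 12 * (1 / real s ^ 2)" .
  qed
  also have "\<dots> = 12 * (\<Sum>s\<in>{1..nat H}. 1 / real s ^ 2)" by (simp only: sum_distrib_left)
  also have "\<dots> \<le> 12 * (2 - 1 / real (nat H))"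
    using assms by (intro mult_left_mono sum_inverse_squares_le) auto
  also have "\<dots> \<le> 24" by simp
  finally show ?thesis .
qed

text \<open>
  A lattice point \<open>u\<close> is determined by the multiple \<open>det (u, v)\<close> of \<open>p\<close>, where \<open>v\<close> is a shortest
  vector of norm \<open>s\<close>, together with the position of \<open>u\<close> up to steps of length \<open>s\<close> in one coordinate.
\<close>

lemma card_lattice_points_le:
  assumes p: "p > 0" and H: "H \<ge> 1"
    and v: "v \<in> lattice_points p {-H..H} c" "v \<noteq> 0"
    and min: "\<And>u. u \<in> lattice_points p {-H..H} c \<Longrightarrow> u \<noteq> 0 \<Longrightarrow> sup_norm v \<le> sup_norm u"
  shows "real (card (lattice_points p {-H..H} c)) \<le>
    12 * real_of_int H ^ 2 / real_of_int p + 3 * real_of_int H / real_of_int (sup_norm v)"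
proof -
  obtain a b where ab: "v = (a, b)" by (cases v)
  define s where "s = sup_norm v"
  have s1: "s \<ge> 1" unfolding s_def by (rule sup_norm_pos[OF v(2)])
  have sH: "s \<le> H" using v(1) by (auto simp: s_def sup_norm_def lattice_points_def)
  have as: "\<bar>a\<bar> \<le> s" "\<bar>b\<bar> \<le> s" by (auto simp: s_def sup_norm_def ab)
  let ?L = "lattice_points p {-H..H} c"
  \<comment> \<open>Since \<open>u\<close> has coordinates at most \<open>H\<close> and
    \<open>v\<close> at most \<open>s\<close>, the determinant is at most \<open>2 * H * s\<close>;
    so \<open>k\<close> bounds its quotient by \<open>p\<close>.\<close>
  define k where "k = (2 * H * s) div p"
  \<comment> \<open>Here \<open>i\<close> is a coordinate in which \<open>v\<close> attains its
    norm.\<close>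
  have main: "card ?L \<le> card ({-k..k} \<times> {0..2 * H div s})"
    if i: "i = fst \<or> i = snd" and iv: "\<bar>i v\<bar> = s" for i :: "int \<times> int \<Rightarrow> int"
  proof (rule card_inj_on_le)
    let ?f = "\<lambda>u. ((fst u * b - snd u * a) div p, (i u + H) div s)"
    have dvd: "p dvd fst u * b - snd u * a" if "u \<in> ?L" for u
    proof -
      have 1: "p dvd snd u - c * fst u" "p dvd b - c * a"
        using that v(1) by (auto simp: lattice_points_def ab)
      have "fst u * b - snd u * a = fst u * (b - c * a) - a * (snd u - c * fst u)"
        by (simp add: algebra_simps)
      with 1 show ?thesis by simp
    qed
    show "inj_on ?f ?L"
    proof (rule inj_onI)
      fix u w assume u: "u \<in> ?L" and w: "w \<in> ?L" and eq: "?f u = ?f w"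
      define x y where "x = fst u - fst w" and "y = snd u - snd w"
      have "fst u * b - snd u * a = fst w * b - snd w * a"
        using eq dvd[OF u] dvd[OF w] by (metis dvd_div_eq_iff prod.inject)
      then have det: "x * b = y * a" by (simp add: x_def y_def algebra_simps)
      have di: "\<bar>i u - i w\<bar> < s"
      proof -
        have q: "(i u + H) div s = (i w + H) div s" using eq by simp
        have "i u + H = s * ((i u + H) div s) + (i u + H) mod s"
          "i w + H = s * ((i w + H) div s) + (i w + H) mod s" by simp_all
        moreover have "0 \<le> (i u + H) mod s" "(i u + H) mod s < s" "0 \<le> (i w + H) mod s" "(i w + H) mod s < s"
          using s1 by simp_all
        ultimately show ?thesis unfolding q by linarith
      qed
      \<comment> \<open>The difference \<open>(x, y)\<close> is proportional to \<open>v\<close>, so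
        smallness in coordinate \<open>i\<close> passes to the other coordinate. Minimality of
        \<open>v\<close> then forces the difference to be zero.\<close>
      have small: "\<bar>x\<bar> < s \<and> \<bar>y\<bar> < s"
        using i
      proof
        assume i: "i = fst"
        have x: "\<bar>x\<bar> < s" using di by (simp add: i x_def)
        have "\<bar>y\<bar> * s = \<bar>x\<bar> * \<bar>b\<bar>" using iv det i ab by (metis abs_mult fst_conv)
        also have "\<dots> \<le> \<bar>x\<bar> * s" using as by (intro mult_left_mono) auto
        finally have "\<bar>y\<bar> \<le> \<bar>x\<bar>" using s1 by simp
        with x show ?thesis by simp
      next
        assume i: "i = snd"
        have y: "\<bar>y\<bar> < s" using di by (simp add: i y_def)
        have "\<bar>x\<bar> * s = \<bar>y\<bar> * \<bar>a\<bar>" using iv det i ab by (metis abs_mult snd_conv)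
        also have "\<dots> \<le> \<bar>y\<bar> * s" using as by (intro mult_left_mono) auto
        finally have "\<bar>x\<bar> \<le> \<bar>y\<bar>" using s1 by simp
        with y show ?thesis by simp
      qed
      have "p dvd (snd u - c * fst u) - (snd w - c * fst w)"
        using u w unfolding lattice_points_def mem_Collect_eq by (metis dvd_diff)
      then have "(x, y) \<in> ?L" using small sH
        by (auto simp: lattice_points_def x_def y_def algebra_simps)
      moreover have "sup_norm (x, y) < s" using small by (simp add: sup_norm_def)
      ultimately have "(x, y) = 0" using min[of "(x, y)"] by (force simp: s_def)
      then show "u = w" by (simp add: x_def y_def zero_prod_def prod_eq_iff)
    qed
    show "?f ` ?L \<subseteq> {-k..k} \<times> {0..2 * H div s}"
    proof (rule image_subsetI)
      fix u assume u: "u \<in> ?L"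
      have uH: "\<bar>fst u\<bar> \<le> H" "\<bar>snd u\<bar> \<le> H" using u by (auto simp: lattice_points_def)
      obtain d where d: "fst u * b - snd u * a = p * d" using dvd[OF u] by (auto simp: dvd_def)
      have "p * \<bar>d\<bar> = \<bar>fst u * b - snd u * a\<bar>" using p by (simp add: d abs_mult)
      also have "\<dots> \<le> \<bar>fst u\<bar> * \<bar>b\<bar> + \<bar>snd u\<bar> * \<bar>a\<bar>"
        by (metis abs_mult abs_triangle_ineq4)
      also have "\<dots> \<le> H * s + H * s" using uH as s1 H by (intro add_mono mult_mono) auto
      finally have "(p * \<bar>d\<bar>) div p \<le> k"
        unfolding k_def using p by (intro zdiv_mono1) auto
      then have "\<bar>d\<bar> \<le> k" using p by simp
      moreover have "(fst u * b - snd u * a) div p = d" using d p by simp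
      moreover have "0 \<le> (i u + H) div s"
        using i uH s1 by (intro pos_imp_zdiv_nonneg_iff[THEN iffD2]) auto
      moreover have "(i u + H) div s \<le> 2 * H div s"
        using i uH s1 by (intro zdiv_mono1) auto
      ultimately show "?f u \<in> {-k..k} \<times> {0..2 * H div s}" by auto
    qed
  qed simp
  have "\<bar>fst v\<bar> = s \<or> \<bar>snd v\<bar> = s" by (auto simp: s_def sup_norm_def)
  then have "card ?L \<le> card ({-k..k} \<times> {0..2 * H div s})" using main[of fst] main[of snd] by blast
  also have "\<dots> = nat (2 * k + 1) * nat (2 * H div s + 1)" by (simp add: card_cartesian_product)
  finally have "real (card ?L) \<le> real (nat (2 * k + 1)) * real (nat (2 * H div s + 1))"
    by (metis of_nat_le_iff of_nat_mult)
  also have "\<dots> \<le> (4 * H * s / p + 1) * (2 * H / s + 1)"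
  proof (rule mult_mono)
    have k0: "k \<ge> 0" using p H s1 by (simp add: k_def pos_imp_zdiv_nonneg_iff)
    have "real_of_int k \<le> (2 * H * s) / p" using real_of_int_div4[of "2 * H * s" p] by (simp add: k_def)
    then show "real (nat (2 * k + 1)) \<le> 4 * H * s / p + 1" using k0 by simp
    have h0: "2 * H div s \<ge> 0" using H s1 by (simp add: pos_imp_zdiv_nonneg_iff)
    have "real_of_int (2 * H div s) \<le> 2 * H / s" using real_of_int_div4[of "2 * H" s] by simp
    then show "real (nat (2 * H div s + 1)) \<le> 2 * H / s + 1" using h0 by simp
    show "0 \<le> 4 * H * s / p + 1" using p H s1 by simp
  qed simp
  also have "\<dots> = 8 * H ^ 2 / p + 4 * (H * s) / p + 2 * H / s + 1"
    using p s1 by (simp add: field_simps power2_eq_square)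
  \<comment> \<open>\<open>s \<le> H\<close> is used twice: to replace \<open>H * s\<close> by
    \<open>H * H\<close>, and 1 by \<open>H / s\<close>.\<close>
  also have "\<dots> \<le> 8 * H ^ 2 / p + 4 * (H * H) / p + 2 * H / s + H / s"
    using p s1 sH H by (intro add_mono divide_right_mono mult_left_mono) (auto simp: field_simps)
  also have "\<dots> = 12 * H ^ 2 / p + 3 * H / s"
    using p s1 by (simp add: field_simps power2_eq_square)
  finally show ?thesis by (simp add: s_def)
qed

text \<open>Summing the pointwise bound over \<open>c\<close> is efficient because the slope
  \<open>c\<close> can be recovered from its shortest vector, so the norms that occur are those of
  distinct vectors of the square.\<close>

lemma sum_card_lattice_points_le:
  assumes p: "prime p" and H: "H \<ge> 1" "2 * H < p"
  shows "(\<Sum>c\<in>{0..<p}. real (card (lattice_points p {-H..H} c)) ^ 3) \<le>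
    real_of_int p + 6912 * real_of_int H ^ 6 / real_of_int p ^ 2 + 2592 * real_of_int H ^ 3"
proof -
  let ?L = "lattice_points p {-H..H}"
  define C where "C = {c \<in> {0..<p}. ?L c - {0} \<noteq> {}}"
  have pp: "p > 0" using p prime_gt_0_int by blast
  have "\<exists>v. v \<in> ?L c \<and> v \<noteq> 0 \<and> (\<forall>u. u \<in> ?L c \<longrightarrow> u \<noteq> 0 \<longrightarrow> sup_norm v \<le> sup_norm u)" if "c \<in> C" for c
  proof -
    let ?m = "arg_min_on sup_norm (?L c - {0})"
    have fin: "finite (?L c - {0})" by (simp add: lattice_points_def)
    have ne: "?L c - {0} \<noteq> {}" using that by (simp add: C_def)
    have "?m \<in> ?L c - {0}" by (rule arg_min_if_finite(1)[OF fin ne])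
    moreover have "sup_norm ?m \<le> sup_norm u" if "u \<in> ?L c - {0}" for u
      by (rule arg_min_least[OF fin ne that])
    ultimately show ?thesis by (metis Diff_iff singletonD singletonI)
  qed
  then obtain f where f: "\<And>c. c \<in> C \<Longrightarrow> f c \<in> ?L c" "\<And>c. c \<in> C \<Longrightarrow> f c \<noteq> 0"
      "\<And>c u. c \<in> C \<Longrightarrow> u \<in> ?L c \<Longrightarrow> u \<noteq> 0 \<Longrightarrow> sup_norm (f c) \<le> sup_norm u"
    by metis
  have small: "x = 0" if "\<bar>x\<bar> \<le> H" "p dvd x" for x
    using that H zdvd_imp_le[of p "\<bar>x\<bar>"] by (cases "x = 0") auto
  have inj: "inj_on f C"
  proof (rule inj_onI)
    fix c d assume c: "c \<in> C" and d: "d \<in> C" and eq: "f c = f d"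
    obtain a b where ab: "f c = (a, b)" by (cases "f c")
    have a: "\<bar>a\<bar> \<le> H" "\<bar>b\<bar> \<le> H" "p dvd b - c * a" and "p dvd b - d * a"
      using f(1)[OF c] f(1)[OF d] eq ab by (auto simp: lattice_points_def)
    then have "p dvd (b - d * a) - (b - c * a)" by (metis dvd_diff)
    then have "p dvd (c - d) * a" by (simp add: algebra_simps)
    \<comment> \<open>Otherwise \<open>p\<close> would divide both coordinates, which are at most
      \<open>H < p\<close> in size, and the shortest vector would be zero.\<close>
    moreover have "\<not> p dvd a"
    proof
      assume "p dvd a"
      then have "p dvd b" using a(3) by (metis diff_add_cancel dvd_add dvd_mult)
      with \<open>p dvd a\<close> a have "a = 0" "b = 0" using small by auto
      with f(2)[OF c] ab show False by (simp add: zero_prod_def)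
    qed
    ultimately have "p dvd c - d" using p by (simp add: prime_dvd_mult_iff)
    moreover have "c \<in> {0..<p}" "d \<in> {0..<p}" using c d by (auto simp: C_def)
    ultimately show "c = d" using separated_residues unfolding separated_def by blast
  qed
  have im: "f ` C \<subseteq> {-H..H} \<times> {-H..H} - {0}"
  proof (rule image_subsetI)
    fix c assume "c \<in> C"
    with f(1)[OF this] f(2)[OF this] show "f c \<in> {-H..H} \<times> {-H..H} - {0}"
      unfolding lattice_points_def by simp
  qed
  let ?H = "real_of_int H" and ?p = "real_of_int p"
  let ?b = "\<lambda>c. if c \<in> C then 1 / real_of_int (sup_norm (f c)) ^ 3 else 0"
  \<comment> \<open>The summand 1 covers the \<open>c\<close> without nonzero lattice point; the
    factors 4 come from \<open>(x + y) ^ 3 \<le> 4 * x ^ 3 + 4 * y ^ 3\<close>.\<close>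
  have "real (card (?L c)) ^ 3 \<le> 1 + 4 * (12 * ?H ^ 2 / ?p) ^ 3 + 4 * (3 * ?H) ^ 3 * ?b c" if c: "c \<in> {0..<p}" for c
  proof (cases "c \<in> C")
    case True
    let ?x = "12 * ?H ^ 2 / ?p" and ?y = "3 * ?H / real_of_int (sup_norm (f c))"
    have s: "sup_norm (f c) \<ge> 1" by (rule sup_norm_pos[OF f(2)[OF True]])
    have "real (card (?L c)) \<le> ?x + ?y"
      using f True by (intro card_lattice_points_le pp H) auto
    then have "real (card (?L c)) ^ 3 \<le> (?x + ?y) ^ 3" by (intro power_mono) auto
    also have "\<dots> \<le> 4 * ?x ^ 3 + 4 * ?y ^ 3"
    proof -
      have "(x + y) ^ 3 \<le> 4 * x ^ 3 + 4 * y ^ 3" if "x \<ge> 0" "y \<ge> 0" for x y :: real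
      proof -
        have "4 * x ^ 3 + 4 * y ^ 3 - (x + y) ^ 3 = 3 * ((x + y) * (x - y) ^ 2)"
          by (simp add: power2_eq_square power3_eq_cube algebra_simps)
        also have "\<dots> \<ge> 0" using that by simp
        finally show ?thesis by simp
      qed
      then show ?thesis using s pp H by simp
    qed
    also have "?y ^ 3 = (3 * ?H) ^ 3 * ?b c" using True by (simp add: power_divide)
    finally show ?thesis by simp
  next
    case False
    then have "?L c \<subseteq> {0}" using c by (auto simp: C_def)
    then have "card (?L c) \<le> 1" using card_mono[of "{0}" "?L c"] by simp
    then have "real (card (?L c)) ^ 3 \<le> 1" by (intro power_le_one) auto
    moreover have "0 \<le> (12 * ?H ^ 2 / ?p) ^ 3" using pp by simp
    ultimately have "real (card (?L c)) ^ 3 \<le> 1 + 4 * (12 * ?H ^ 2 / ?p) ^ 3" by linarith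
    then show ?thesis using False by simp
  qed
  then have "(\<Sum>c\<in>{0..<p}. real (card (?L c)) ^ 3) \<le>
      (\<Sum>c\<in>{0..<p}. 1 + 4 * (12 * ?H ^ 2 / ?p) ^ 3 + 4 * (3 * ?H) ^ 3 * ?b c)"
    by (rule sum_mono)
  also have "\<dots> = ?p * (1 + 4 * (12 * ?H ^ 2 / ?p) ^ 3) + 4 * (3 * ?H) ^ 3 * (\<Sum>c\<in>{0..<p}. ?b c)"
    using pp by (simp add: sum.distrib sum_distrib_left)
  also have "(\<Sum>c\<in>{0..<p}. ?b c) = (\<Sum>c\<in>C. 1 / real_of_int (sup_norm (f c)) ^ 3)"
  proof -
    have "{0..<p} \<inter> C = C" by (auto simp: C_def)
    then show ?thesis by (simp add: sum.If_cases Int_commute)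
  qed
  also have "\<dots> = (\<Sum>v\<in>f ` C. 1 / real_of_int (sup_norm v) ^ 3)"
    by (simp add: sum.reindex[OF inj])
  also have "4 * (3 * ?H) ^ 3 * (\<Sum>v\<in>f ` C. 1 / real_of_int (sup_norm v) ^ 3) \<le> 4 * (3 * ?H) ^ 3 * 24"
  proof (rule mult_left_mono)
    have "(\<Sum>v\<in>f ` C. 1 / real_of_int (sup_norm v) ^ 3) \<le>
        (\<Sum>v\<in>{-H..H} \<times> {-H..H} - {0}. 1 / real_of_int (sup_norm v) ^ 3)"
      using im by (intro sum_mono2) (auto simp: sup_norm_def)
    also have "\<dots> \<le> 24" by (rule sum_inverse_cube_sup_norm_le[OF H(1)])
    finally show "(\<Sum>v\<in>f ` C. 1 / real_of_int (sup_norm v) ^ 3) \<le> 24" .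
  qed (use H in simp)
  also have "?p * (1 + 4 * (12 * ?H ^ 2 / ?p) ^ 3) + 4 * (3 * ?H) ^ 3 * 24 =
      ?p + 6912 * ?H ^ 6 / ?p ^ 2 + 2592 * ?H ^ 3"
    using pp by (simp add: field_simps eval_nat_numeral)
  finally show ?thesis by simp
qed

section \<open>From parallel pairs in space to plane lattices\<close>

lemma exists_dot_eq_1:
  assumes "prime p" "\<not> null p u"
  shows "\<exists>x. p dvd dot x u - 1"
proof -
  have inv: "\<exists>e. p dvd e * a - 1" if "\<not> p dvd a" for a
  proof -
    have "coprime a p" using that assms(1) by (metis prime_imp_coprime coprime_commute)
    then show ?thesis using cong_solve_coprime_int[of a p] by (auto simp: cong_iff_dvd_diff mult.commute)
  qed
  obtain a b d where u: "u = (a, b, d)" by (cases u)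
  with assms(2) consider "\<not> p dvd a" | "\<not> p dvd b" | "\<not> p dvd d" by auto
  then show ?thesis
  proof cases
    case 1
    from inv[OF this] obtain e where "p dvd e * a - 1" ..
    then show ?thesis by (intro exI[of _ "(e, 0, 0)"]) (simp add: u)
  next
    case 2
    from inv[OF this] obtain e where "p dvd e * b - 1" ..
    then show ?thesis by (intro exI[of _ "(0, e, 0)"]) (simp add: u)
  next
    case 3
    from inv[OF this] obtain e where "p dvd e * d - 1" ..
    then show ?thesis by (intro exI[of _ "(0, 0, e)"]) (simp add: u)
  qed
qed

text \<open>Choose \<open>x\<close> with \<open>dot x u\<close> congruent to 1. The triple product
  of \<open>x\<close>, \<open>v\<close>, \<open>u\<close> then shows that \<open>v\<close> is
  \<open>dot x v\<close> times \<open>u\<close> modulo \<open>p\<close>.\<close>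

lemma null_cross_imp_multiple:
  assumes p: "prime p" and u: "\<not> null p u" and uv: "null p (cross u v)"
  shows "\<exists>c\<in>{0..<p}. null p (v - scale c u)"
proof -
  have pp: "p > 0" using p prime_gt_0_int by blast
  obtain x where x: "p dvd dot x u - 1" using exists_dot_eq_1[OF p u] ..
  define c where "c = dot x v mod p"
  have null_add: "null p (a + b)" if "null p a" "null p b" for a b
    using that by (cases a; cases b) auto
  have null_cross: "null p (cross x b)" if "null p b" for b
    using that by (cases x; cases b) auto
  have "p dvd dot x v - c" by (simp add: c_def mod_eq_dvd_iff[symmetric])
  have "v - scale c u = (scale (dot x v - c) u - scale (dot x u - 1) v) + cross x (cross v u)"
    unfolding cross_cross by (cases u; cases v; cases x) (simp add: algebra_simps)
  moreover have "null p (scale (dot x v - c) u - scale (dot x u - 1) v + cross x (cross v u))"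
    using x uv \<open>p dvd dot x v - c\<close>
    by (intro null_add null_diff null_scale null_cross) (auto simp: null_cross_commute[of p v])
  moreover have "c \<in> {0..<p}" using pp by (simp add: c_def)
  ultimately show ?thesis by metis
qed

text \<open>Regrouping a pair of vectors by coordinates turns it into three points of the same
  lattice; this is the source of the cube.\<close>

lemma card_multiples_le:
  assumes "finite S"
  shows "card {x \<in> cube S \<times> cube S. null p (snd x - scale c (fst x))} \<le> card (lattice_points p S c) ^ 3"
proof -
  let ?L = "lattice_points p S c"
  let ?g = "\<lambda>((a, b, d), (x, y, z)). ((a, x), (b, y), (d, z))"
  have "card {x \<in> cube S \<times> cube S. null p (snd x - scale c (fst x))} \<le> card (?L \<times> ?L \<times> ?L)"
  proof (rule card_inj_on_le)
    show "inj_on ?g {x \<in> cube S \<times> cube S. null p (snd x - scale c (fst x))}"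
      by (auto simp: inj_on_def)
    show "?g ` {x \<in> cube S \<times> cube S. null p (snd x - scale c (fst x))} \<subseteq> ?L \<times> ?L \<times> ?L"
      by (auto simp: lattice_points_def cube_def)
    show "finite (?L \<times> ?L \<times> ?L)" using assms by (simp add: lattice_points_def)
  qed
  then show ?thesis by (simp add: card_cartesian_product power3_eq_cube)
qed

lemma (in prime_box) D_le: "D \<le> N ^ 3 + (\<Sum>c\<in>{0..<p}. real (card (lattice_points p S c)) ^ 3)"
proof -
  let ?A = "\<lambda>c. {x \<in> V \<times> V. null p (snd x - scale c (fst x))}"
  have "D = (\<Sum>x\<in>V \<times> V. of_bool (null p (cross (fst x) (snd x))))"
    unfolding D_def by (simp only: sum.cartesian_product case_prod_unfold)
  also have "\<dots> = real (card {x \<in> V \<times> V. null p (cross (fst x) (snd x))})"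
    using finite_V by (intro sum_of_bool_card) auto
  also have "card {x \<in> V \<times> V. null p (cross (fst x) (snd x))} \<le> card ({0} \<times> V \<union> (\<Union>c\<in>{0..<p}. ?A c))"
  proof (rule card_mono)
    show "finite ({0} \<times> V \<union> (\<Union>c\<in>{0..<p}. ?A c))" using finite_V by auto
    show "{x \<in> V \<times> V. null p (cross (fst x) (snd x))} \<subseteq> {0} \<times> V \<union> (\<Union>c\<in>{0..<p}. ?A c)"
    proof
      fix x assume "x \<in> {x \<in> V \<times> V. null p (cross (fst x) (snd x))}"
      then have x: "x \<in> V \<times> V" "null p (cross (fst x) (snd x))" by auto
      show "x \<in> {0} \<times> V \<union> (\<Union>c\<in>{0..<p}. ?A c)"
      proof (cases "fst x = 0")
        case True
        then show ?thesis using x(1) by auto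
      next
        case False
        then have "\<not> null p (fst x)" using null_V[of "fst x"] x(1) by auto
        from null_cross_imp_multiple[OF p this x(2)] x(1) show ?thesis by blast
      qed
    qed
  qed
  also have "card ({0} \<times> V \<union> (\<Union>c\<in>{0..<p}. ?A c)) \<le> card ({0::vec} \<times> V) + card (\<Union>c\<in>{0..<p}. ?A c)"
    by (rule card_Un_le)
  also have "card (\<Union>c\<in>{0..<p}. ?A c) \<le> (\<Sum>c\<in>{0..<p}. card (?A c))"
    by (rule card_UN_le) simp
  also have "\<dots> \<le> (\<Sum>c\<in>{0..<p}. card (lattice_points p S c) ^ 3)"
    by (intro sum_mono card_multiples_le finite_S)
  finally show ?thesis by (simp add: card_cartesian_product real_card_V)
qed

subsection \<open>The number of matrices\<close>

text \<open>Reduction is injective on \<open>S\<close>, so matrices of residues correspond to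
  triples of rows in the box, and the determinant is the triple product of the rows modulo
  \<open>p\<close>.\<close>

lemma card_det_eq_card_dot_cross:
  assumes p: "p > 0" and sep: "separated p S"
  shows "card {M :: int^3^3. (\<forall>i j. M $ i $ j \<in> (\<lambda>x. x mod p) ` S) \<and> [det M = t] (mod p)} =
    card {x \<in> (cube S \<times> cube S) \<times> cube S.
      p dvd dot (snd x) (cross (fst (fst x)) (snd (fst x))) - t}" (is "card ?X = card ?Y")
proof -
  let ?row = "\<lambda>(a, b, c). vector [a mod p, b mod p, c mod p] :: int^3"
  let ?h = "\<lambda>((u, v), r). vector [?row u, ?row v, ?row r] :: int^3^3"
  have inj: "x = y" if "x \<in> S" "y \<in> S" "x mod p = y mod p" for x y
    using sep that by (auto simp: separated_def mod_eq_dvd_iff)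
  have det: "[det (?h ((u, v), r)) = dot r (cross u v)] (mod p)" for u v r
  proof -
    obtain a b c d e f g h i where uvr: "u = (a, b, c)" "v = (d, e, f)" "r = (g, h, i)"
      by (cases u; cases v; cases r)
    have m: "[x mod p = x] (mod p)" for x by simp
    have "[det (?h ((u, v), r)) = a * e * i + b * f * g + c * d * h - a * f * h - b * d * i - c * e * g] (mod p)"
      unfolding uvr det_3 prod.case vector_3 by (intro cong_add cong_diff cong_mult m)
    also have "a * e * i + b * f * g + c * d * h - a * f * h - b * d * i - c * e * g = dot r (cross u v)"
      by (simp add: uvr algebra_simps)
    finally show ?thesis .
  qed
  have "bij_betw ?h ?Y ?X"
  proof (rule bij_betw_imageI)
    show "inj_on ?h ?Y"
    proof (rule inj_onI)
      fix x y assume xy: "x \<in> ?Y" "y \<in> ?Y" "?h x = ?h y"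
      obtain a b c d e f g h i where x: "x = (((a, b, c), (d, e, f)), (g, h, i))"
        by (metis prod.exhaust)
      obtain a' b' c' d' e' f' g' h' i' where y: "y = (((a', b', c'), (d', e', f')), (g', h', i'))"
        by (metis prod.exhaust)
      have "?h x $ i $ j = ?h y $ i $ j" for i j by (simp only: xy(3))
      from this[of 1 1] this[of 1 2] this[of 1 3] this[of 2 1] this[of 2 2] this[of 2 3]
        this[of 3 1] this[of 3 2] this[of 3 3]
      show "x = y" using xy(1,2)
        by (simp add: x y cube_def inj)
    qed
    show "?h ` ?Y = ?X"
    proof (rule set_eqI, rule iffI)
      fix M assume "M \<in> ?h ` ?Y"
      then obtain u v r where uvr: "u \<in> cube S" "v \<in> cube S" "r \<in> cube S"
          "p dvd dot r (cross u v) - t" and M: "M = ?h ((u, v), r)"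
        by auto
      have "[dot r (cross u v) = t] (mod p)" using uvr(4) by (simp add: cong_iff_dvd_diff)
      then have "[det M = t] (mod p)" unfolding M by (rule cong_trans[OF det])
      moreover have "\<forall>i j. M $ i $ j \<in> (\<lambda>x. x mod p) ` S"
        using uvr(1-3) unfolding M forall_3 by (cases u; cases v; cases r) (simp add: cube_def)
      ultimately show "M \<in> ?X" by simp
    next
      fix M assume M: "M \<in> ?X"
      then have "\<forall>i j. \<exists>x. x \<in> S \<and> M $ i $ j = x mod p" by auto
      then obtain l where l: "\<And>i j. l i j \<in> S" "\<And>i j. M $ i $ j = l i j mod p" by metis
      let ?v = "\<lambda>i. (l i 1, l i 2, l i 3)"
      let ?x = "((?v 1, ?v 2), ?v 3)"
      have h: "?h ?x = M" by (simp add: vec_eq_iff forall_3 l(2))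
      have "[det (?h ?x) = t] (mod p)" using M unfolding h by blast
      then have "[dot (?v 3) (cross (?v 1) (?v 2)) = t] (mod p)"
        by (rule cong_trans[OF cong_sym[OF det]])
      then have "?x \<in> ?Y" using l(1) by (simp add: cube_def cong_iff_dvd_diff)
      then show "M \<in> ?h ` ?Y" by (rule image_eqI[where x = ?x, rotated]) (rule h[symmetric])
    qed
  qed
  then show ?thesis by (rule bij_betw_same_card[symmetric])
qed

lemma separated_symmetric_interval: "2 * H < p \<Longrightarrow> separated p {-H..H}" for p :: int
proof -
  assume H: "2 * H < p"
  have "x = y" if "x \<in> {-H..H}" "y \<in> {-H..H}" "p dvd x - y" for x y
  proof (rule ccontr)
    assume "x \<noteq> y"
    then have "p \<le> \<bar>x - y\<bar>" using that(3) by (intro zdvd_imp_le) auto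
    with that H show False by auto
  qed
  then show ?thesis by (simp add: separated_def)
qed

lemma (in prime_box) real_N3:
  assumes "p = int m" "S = {-int H..int H}"
  shows "real (N3 m (residue_interval m H) t) = (\<Sum>x\<in>V \<times> V. M t (cross (fst x) (snd x)))"
proof -
  have "(\<Sum>x\<in>V \<times> V. M t (cross (fst x) (snd x))) =
      (\<Sum>x\<in>(V \<times> V) \<times> V. of_bool (p dvd dot (snd x) (cross (fst (fst x)) (snd (fst x))) - t))"
    unfolding M_def by (simp only: sum.cartesian_product' fst_conv snd_conv)
  also have "\<dots> = real (card {x \<in> (V \<times> V) \<times> V. p dvd dot (snd x) (cross (fst (fst x)) (snd (fst x))) - t})"
    using finite_V by (intro sum_of_bool_card) auto
  also have "\<dots> = real (N3 m (residue_interval m H) t)"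
    unfolding N3_def residue_interval_def
    using card_det_eq_card_dot_cross[OF _ S, of t] p_gt assms by simp
  finally show ?thesis by simp
qed

section \<open>Assembling the error term\<close>

text \<open>Pure real arithmetic: \<open>q ^ 3 \<le> N ^ 5\<close> lets every secondary term be
  absorbed into a power of \<open>N\<close>. The constant is \<open>507 = 73 + 434\<close>, one
  summand for each part of \<open>E\<close>.\<close>

lemma relative_error:
  fixes N q D T E :: real
  assumes N: "1 \<le> N" "N \<le> q" and q: "2 \<le> q" and Nq: "q ^ 3 \<le> N ^ 5" and T0: "0 \<le> T" and D0: "0 \<le> D"
    and D: "D \<le> 325 * N ^ 3 + q + 108 * N ^ 6 / q ^ 2"
    and T: "(q - 1) * T \<le> 2 * N ^ 6 * q + 2 * N ^ 9 + 2 * N ^ 2 * (q ^ 2 * D + q ^ 3)"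
    and E: "E \<le> sqrt (3 * q ^ 2 * N ^ 4 * T) + N ^ 3 / q * D"
  shows "E \<le> 507 * sqrt (q ^ 3 / N ^ 5) * (N ^ 9 / q)"
proof -
  have q2: "q ^ 2 \<le> N ^ 4"
  proof -
    have "(q ^ 2) ^ 3 = (q ^ 3) ^ 2" by simp
    also have "\<dots> \<le> (N ^ 5) ^ 2" using q by (intro power_mono Nq) auto
    also have "\<dots> \<le> (N ^ 4) ^ 3" unfolding power_mult[symmetric] using N by (intro power_increasing) auto
    finally show ?thesis using N q by (subst (asm) power_mono_iff) auto
  qed
  have q1: "q \<le> N ^ 3"
  proof -
    have "q ^ 3 \<le> N ^ 9" using Nq power_increasing[of 5 9 N] N by simp
    then have "q ^ 3 \<le> (N ^ 3) ^ 3" by simp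
    then show ?thesis using N q by (subst (asm) power_mono_iff) auto
  qed
  \<comment> \<open>\<open>434 = 326 + 108\<close>, after \<open>q\<close> is absorbed into
    \<open>N ^ 3\<close>.\<close>
  have qD: "q ^ 2 * D \<le> 434 * N ^ 7"
  proof -
    have "q ^ 2 * D \<le> q ^ 2 * (326 * N ^ 3 + 108 * N ^ 6 / q ^ 2)"
      using D q1 by (intro mult_left_mono) auto
    also have "\<dots> = 326 * (N ^ 3 * q ^ 2) + 108 * N ^ 6" using q by (simp add: field_simps)
    also have "\<dots> \<le> 326 * (N ^ 3 * N ^ 4) + 108 * N ^ 7"
      using q2 N by (intro add_mono mult_left_mono power_increasing) auto
    finally show ?thesis by simp
  qed
  have T': "q * T \<le> 1748 * N ^ 9"
  proof -
    have "N ^ 6 * q \<le> N ^ 6 * N ^ 3" using q1 N by (intro mult_left_mono) auto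
    moreover have "N ^ 2 * (q ^ 2 * D + q ^ 3) \<le> N ^ 2 * (434 * N ^ 7 + N ^ 7)"
      using qD Nq power_increasing[of 5 7 N] N by (intro mult_left_mono add_mono) auto
    moreover have "N ^ 2 * (434 * N ^ 7 + N ^ 7) = 435 * N ^ 9" "N ^ 6 * N ^ 3 = N ^ 9"
      by algebra+
    \<comment> \<open>\<open>874 = 2 * (1 + 1 + 435)\<close>; passing from \<open>q - 1\<close> to
      \<open>q\<close> below costs a factor 2.\<close>
    ultimately have "(q - 1) * T \<le> 874 * N ^ 9" using T by linarith
    moreover have "q / 2 * T \<le> (q - 1) * T" using q T0 by (intro mult_right_mono) auto
    ultimately show ?thesis by simp
  qed
  define \<delta> where "\<delta> = sqrt (q ^ 3 / N ^ 5)"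
  have \<delta>: "\<delta> \<ge> 1 / q"
  proof -
    have "N ^ 5 \<le> q ^ 5" using N by (intro power_mono) auto
    then have "(1 / q) ^ 2 \<le> q ^ 3 / N ^ 5"
      using N q by (simp add: field_simps flip: power_add)
    then show ?thesis unfolding \<delta>_def by (rule real_le_rsqrt)
  qed
  \<comment> \<open>\<open>73\<close> is the least integer whose square, 5329, is at least
    \<open>5244 = 3 * 1748\<close>.\<close>
  have 1: "sqrt (3 * q ^ 2 * N ^ 4 * T) \<le> 73 * \<delta> * (N ^ 9 / q)"
  proof (rule real_le_lsqrt)
    have "3 * q ^ 2 * N ^ 4 * T = 3 * q * N ^ 4 * (q * T)" by (simp add: power2_eq_square)
    also have "\<dots> \<le> 3 * q * N ^ 4 * (1748 * N ^ 9)" using T' q N by (intro mult_left_mono) auto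
    also have "\<dots> = 5244 * (q * N ^ 13)" by simp
    also have "\<dots> \<le> 73\<^sup>2 * (q * N ^ 13)" using q N by (intro mult_right_mono) auto
    also have "q * N ^ 13 = q ^ 3 / N ^ 5 * (N ^ 9 / q)\<^sup>2"
      using q N by (simp add: field_simps power2_eq_square[of q] power3_eq_cube[of q] flip: power_add)
    also have "q ^ 3 / N ^ 5 = \<delta>\<^sup>2" using q N by (simp add: \<delta>_def)
    finally show "3 * q ^ 2 * N ^ 4 * T \<le> (73 * \<delta> * (N ^ 9 / q))\<^sup>2" by (simp only: power_mult_distrib mult.assoc)
    show "0 \<le> 73 * \<delta> * (N ^ 9 / q)" using q N by (simp add: \<delta>_def)
  qed
  \<comment> \<open>The parallel pairs cost a relative error of order \<open>1 / q\<close>, which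
    \<open>\<delta>\<close> dominates because \<open>N \<le> q\<close>.\<close>
  have 2: "N ^ 3 / q * D \<le> 434 * \<delta> * (N ^ 9 / q)"
  proof -
    have "D \<le> 434 * N ^ 7 / q ^ 2" using qD q by (simp add: field_simps)
    also have "\<dots> \<le> 434 * N ^ 6 * q / q ^ 2"
    proof -
      have "N ^ 7 = N ^ 6 * N" by (simp add: eval_nat_numeral)
      also have "\<dots> \<le> N ^ 6 * q" using N by (intro mult_left_mono) auto
      finally show ?thesis by (intro divide_right_mono) auto
    qed
    also have "\<dots> = 434 * N ^ 6 * (1 / q)" using q by (simp add: field_simps power2_eq_square)
    also have "\<dots> \<le> 434 * N ^ 6 * \<delta>" using \<delta> N by (intro mult_left_mono) auto
    finally have "N ^ 3 / q * D \<le> N ^ 3 / q * (434 * N ^ 6 * \<delta>)"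
      using q N by (intro mult_left_mono) auto
    then show ?thesis by (simp add: mult_ac)
  qed
  show ?thesis using E 1 2 unfolding \<delta>_def[symmetric] by linarith
qed

lemma N3_asymptotics:
  fixes m H :: nat
  assumes m: "prime m" and H: "1 \<le> H" "2 * H < m" and t: "t \<in> {1..<int m}"
    and large: "real m ^ 3 \<le> (2 * real H + 1) ^ 5"
  shows "\<bar>real (N3 m (residue_interval m H) t) - (2 * real H + 1) ^ 9 / real m\<bar>
    \<le> 507 * sqrt (real m ^ 3 / (2 * real H + 1) ^ 5) * ((2 * real H + 1) ^ 9 / real m)"
proof -
  let ?S = "{-int H..int H}"
  interpret prime_box "int m" ?S
    using m H separated_symmetric_interval[of "int H" "int m"] by unfold_locales auto
  have N: "real (card ?S) = 2 * real H + 1" by simp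
  have t': "\<not> int m dvd t" using t zdvd_imp_le[of "int m" t] by auto
  have D0: "D \<ge> 0" unfolding D_def by (intro sum_nonneg) auto
  \<comment> \<open>Passing from \<open>H\<close> to \<open>N > 2 * H\<close> turns 6912 into
    \<open>108 = 6912 / 2 ^ 6\<close> and 2592 into \<open>324 = 2592 / 2 ^ 3\<close>; one further
    \<open>N ^ 3\<close> comes from \<open>D_le\<close>.\<close>
  have D: "D \<le> 325 * N ^ 3 + real m + 108 * N ^ 6 / real m ^ 2"
  proof -
    note D_le
    also have "(\<Sum>c\<in>{0..<int m}. real (card (lattice_points (int m) ?S c)) ^ 3)
        \<le> real m + 6912 * real H ^ 6 / real m ^ 2 + 2592 * real H ^ 3"
      using sum_card_lattice_points_le[OF p, of "int H"] H by simp
    also have "6912 * real H ^ 6 = 108 * (2 * real H) ^ 6" by (simp add: power_mult_distrib)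
    also have "\<dots> \<le> 108 * N ^ 6" unfolding N by (intro mult_left_mono power_mono) auto
    also have "2592 * real H ^ 3 = 324 * (2 * real H) ^ 3" by (simp add: power_mult_distrib)
    also have "\<dots> \<le> 324 * N ^ 3" unfolding N by (intro mult_left_mono power_mono) auto
    finally show ?thesis by (simp add: divide_right_mono)
  qed
  show ?thesis
  proof (rule relative_error[OF _ _ _ large T_nonneg D0])
    show "D \<le> 325 * (2 * real H + 1) ^ 3 + real m + 108 * (2 * real H + 1) ^ 6 / real m ^ 2"
      using D unfolding N by simp
    show "(real m - 1) * T \<le> 2 * (2 * real H + 1) ^ 6 * real m + 2 * (2 * real H + 1) ^ 9 +
        2 * (2 * real H + 1) ^ 2 * (real m ^ 2 * D + real m ^ 3)"
      using T_bound unfolding N of_int_of_nat_eq .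
    show "\<bar>real (N3 m (residue_interval m H) t) - (2 * real H + 1) ^ 9 / real m\<bar>
        \<le> sqrt (3 * real m ^ 2 * (2 * real H + 1) ^ 4 * T) + (2 * real H + 1) ^ 3 / real m * D"
      using count_deviation[OF t'] unfolding N of_int_of_nat_eq real_N3[OF refl refl] .
  qed (use H in auto)
qed

text \<open>The limit is taken along arbitrary sequences of primes, heights and targets, so
  \<open>t\<close> may vary freely with \<open>p\<close>.\<close>

theorem theorem5:
  fixes p H :: "nat \<Rightarrow> nat" and t :: "nat \<Rightarrow> int"
  assumes "\<And>n. prime (p n)" and "\<And>n. odd (p n)"
    and "filterlim p at_top sequentially"
    and "\<And>n. 1 \<le> H n" and "\<And>n. H n \<le> (p n - 1) div 2"
    and "\<And>n. t n \<in> {1..<int (p n)}"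
    and "(\<lambda>n. real (H n)) \<in> \<omega>(\<lambda>n. real (p n) powr (3/5))"
  shows "\<exists>\<epsilon> :: nat \<Rightarrow> real. \<epsilon> \<in> o(\<lambda>n. 1) \<and>
    (\<forall>n. real (N3 (p n) (residue_interval (p n) (H n)) (t n))
         = (1 + \<epsilon> n) * ((2 * real (H n) + 1) ^ 9 / real (p n)))"
proof -
  define main where "main n = (2 * real (H n) + 1) ^ 9 / real (p n)" for n
  \<comment> \<open>The exact relative error, so the claimed identity holds for every
    \<open>n\<close> and only its convergence to 0 needs proof.\<close>
  define \<epsilon> where "\<epsilon> n = real (N3 (p n) (residue_interval (p n) (H n)) (t n)) / main n - 1" for n
  define \<delta> where "\<delta> n = real (p n) ^ 3 / (2 * real (H n) + 1) ^ 5" for n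
  have p0: "p n > 0" for n using assms(1) prime_gt_0_nat by blast
  have main0: "main n > 0" for n using p0[of n] by (simp add: main_def)
  have "2 * H n < p n" for n using assms(5)[of n] p0[of n] by linarith
  note H = this
  \<comment> \<open>The fifth power of \<open>p powr (3/5) / H\<close> is
    \<open>p ^ 3 / H ^ 5\<close>, which dominates \<open>\<delta>\<close>; the growth hypothesis on
    \<open>H\<close> sends it to 0.\<close>
  have \<delta>: "\<delta> \<longlonglongrightarrow> 0"
  proof (rule tendsto_sandwich[of "\<lambda>_. 0" _ _ "\<lambda>n. (real (p n) powr (3/5) / real (H n)) ^ 5"])
    have "(\<lambda>n. real (p n) powr (3/5)) \<in> o(\<lambda>n. real (H n))"
      using assms(7) by (simp add: smallomega_iff_smallo)
    then have "(\<lambda>n. real (p n) powr (3/5) / real (H n)) \<longlonglongrightarrow> 0" by (rule smalloD_tendsto)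
    then show "(\<lambda>n. (real (p n) powr (3/5) / real (H n)) ^ 5) \<longlonglongrightarrow> 0"
      using tendsto_power[of _ 0 sequentially 5] by fastforce
    show "\<forall>\<^sub>F n in sequentially. 0 \<le> \<delta> n" by (simp add: \<delta>_def)
    show "\<forall>\<^sub>F n in sequentially. \<delta> n \<le> (real (p n) powr (3/5) / real (H n)) ^ 5"
    proof (rule always_eventually, rule allI)
      fix n
      have "(real (p n) powr (3/5)) ^ 5 = real (p n) ^ 3"
        using p0[of n] by (simp add: powr_power powr_numeral)
      moreover have "real (H n) ^ 5 \<le> (2 * real (H n) + 1) ^ 5" by (intro power_mono) auto
      ultimately show "\<delta> n \<le> (real (p n) powr (3/5) / real (H n)) ^ 5"
        using assms(4)[of n] unfolding \<delta>_def power_divide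
        by (intro frac_le) auto
    qed
  qed simp
  have "\<epsilon> \<longlonglongrightarrow> 0"
  proof (rule Lim_null_comparison)
    have "\<forall>\<^sub>F n in sequentially. \<delta> n < 1" using \<delta> by (rule order_tendstoD) simp
    then show "\<forall>\<^sub>F n in sequentially. norm (\<epsilon> n) \<le> 507 * sqrt (\<delta> n)"
    proof (rule eventually_mono)
      fix n assume "\<delta> n < 1"
      \<comment> \<open>This supplies the size condition of \<open>N3_asymptotics\<close>, available
        only for large \<open>n\<close>.\<close>
      then have "real (p n) ^ 3 \<le> (2 * real (H n) + 1) ^ 5" by (simp add: \<delta>_def field_simps)
      from N3_asymptotics[OF assms(1,4) H assms(6) this]
      have "\<bar>real (N3 (p n) (residue_interval (p n) (H n)) (t n)) - main n\<bar> \<le> 507 * sqrt (\<delta> n) * main n"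
        by (simp add: main_def \<delta>_def)
      moreover have "real (N3 (p n) (residue_interval (p n) (H n)) (t n)) - main n = \<epsilon> n * main n"
        using main0[of n] by (simp add: \<epsilon>_def field_simps)
      ultimately have "\<bar>\<epsilon> n\<bar> * main n \<le> 507 * sqrt (\<delta> n) * main n"
        using main0[of n] by (simp add: abs_mult)
      then show "norm (\<epsilon> n) \<le> 507 * sqrt (\<delta> n)" using main0[of n] by simp
    qed
    show "(\<lambda>n. 507 * sqrt (\<delta> n)) \<longlonglongrightarrow> 0"
      using tendsto_mult_right_zero[OF tendsto_real_sqrt[OF \<delta>, simplified]] .
  qed
  then have "\<epsilon> \<in> o(\<lambda>n. 1)" by (intro smalloI_tendsto) auto
  moreover have "real (N3 (p n) (residue_interval (p n) (H n)) (t n)) = (1 + \<epsilon> n) * main n" for n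
    using main0[of n] by (simp add: \<epsilon>_def)
  ultimately show ?thesis unfolding main_def by blast
qed

end
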